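(* $\mathrm{LTL}_{\mathbb{R}}$ verification of Memoryful Neural Multi-Agent Systems is undecidable: there is no algorithm which, given a linearly definable MN-MAS $S$ and an $\mathrm{LTL}_{\mathbb{R}}$ formula $\phi$, decides whether $S\models\phi$.
   Context: A Memoryful Neural Multi-Agent System (MN-MAS) $S$ consists of: an environment state space $\mathcal{X}\subseteq\mathbb{R}^m$ with initial states $\mathcal{X}^{(0)}\subseteq\mathcal{X}$; $s$ agents, agent $i$ having an action space $\mathcal{A}_i$, observation space $\mathcal{O}_i$, observation function $o_i:\mathcal{X}\to\mathcal{O}_i$, hidden-state set $\mathcal{H}_i\subseteq\mathbb{R}^{n_i}$ with initial hidden states $\mathcal{H}_i^{(0)}$, and recurrent policy $r_i:\mathcal{O}_i\times\mathcal{H}_i\to\mathcal{A}_i\times\mathcal{H}_i$; and a non-deterministic transition relation $\tau:\mathcal{X}\times\mathcal{A}\to2^{\mathcal{X}}$, $\mathcal{A}=\prod_i\mathcal{A}_i$. With $\mathcal{H}=\prod_i\mathcal{H}_i$, $\mathcal{H}^{(0)}=\prod_i\mathcal{H}^{(0)}_i$, $o=(o_1,\dots,o_s)$, $r=(r_1,\dots,r_s)$, a path is $\pi=(\bm{x}^{(0)},\bm{h}^{(0)},\bm{x}^{(1)},\bm{h}^{(1)},\dots)$ with $(\bm{a}^{(t)},\bm{h}^{(t+1)})=r(o(\bm{x}^{(t)}),\bm{h}^{(t)})$ and $\bm{x}^{(t+1)}\in\tau(\bm{x}^{(t)},\bm{a}^{(t)})$. Linearly definable means $\tau,r,o,\mathcal{X}^{(0)},\mathcal{H}^{(0)}$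 are expressible by finite conjunctions and disjunctions of linear inequalities with rational coefficients. $\mathrm{LTL}_{\mathbb{R}}$ formulae: $\phi::=\bm{c}^{\top}\bm{x}\le d\mid\neg\phi\mid\phi\wedge\phi\mid\phi\vee\phi\mid\bigcirc\phi\mid\phi\,\mathcal{U}\,\phi\mid\phi\,\mathcal{R}\,\phi\mid\square\phi\mid\lozenge\phi$, interpreted at time $t$ of a path: atoms iff $\bm{c}^{\top}\bm{x}^{(t)}\le d$; Boolean connectives as usual; $\bigcirc\phi$ iff $\phi$ at $t+1$; $\square\phi$ iff $\phi$ at all $t+i$, $i\ge0$; $\lozenge\phi$ iff $\phi$ at some $t+i$; $\psi\,\mathcal{U}\,\phi$ iff $\exists i\ge0$: $\phi$ at $t+i$ and $\psi$ at $t+j$ for all $j<i$; $\psi\,\mathcal{R}\,\phi$ iff either $\phi$ at all $t+i$, or $\exists i\ge0$: $\psi$ at $t+i$ and $\phi$ at $t+j$ for all $0\le j\le i$. $S\models\phi$ means $\phi$ holds at time $0$ on every path with $\bm{x}^{(0)}\in\mathcal{X}^{(0)}$, $\bm{h}^{(0)}\in\mathcal{H}^{(0)}$. *)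

theory Defs
  imports Complex_Main "HOL-Library.Nat_Bijection"
begin

section \<open>Algorithms: partial recursive functions\<close>

datatype recf =
    Zero
  | Succ
  | Proj nat
  | Comp recf "recf list"
  | PrimRec recf recf
  | Mu recf

inductive rec_eval :: "recf \<Rightarrow> nat list \<Rightarrow> nat \<Rightarrow> bool" where
  Zero: "rec_eval Zero xs 0"
| Succ: "rec_eval Succ [x] (Suc x)"
| Proj: "i < length xs \<Longrightarrow> rec_eval (Proj i) xs (xs ! i)"
| Comp: "list_all2 (\<lambda>g y. rec_eval g xs y) gs ys \<Longrightarrow> rec_eval f ys z
    \<Longrightarrow> rec_eval (Comp f gs) xs z"
| PrimRec_0: "rec_eval f xs z \<Longrightarrow> rec_eval (PrimRec f g) (0 # xs) z"
| PrimRec_Suc: "rec_eval (PrimRec f g) (n # xs) y \<Longrightarrow> rec_eval g (n # y # xs) z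
    \<Longrightarrow> rec_eval (PrimRec f g) (Suc n # xs) z"
| Mu: "rec_eval f (y # xs) 0 \<Longrightarrow> (\<forall>i<y. \<exists>v>0. rec_eval f (i # xs) v)
    \<Longrightarrow> rec_eval (Mu f) xs y"

inductive_cases rec_evalE:
  "rec_eval Zero xs z" "rec_eval Succ xs z" "rec_eval (Proj i) xs z" "rec_eval (Comp f gs) xs z"
  "rec_eval (PrimRec f g) (0 # xs) z" "rec_eval (PrimRec f g) (Suc n # xs) z"
  "rec_eval (Mu f) xs z"

lemma rec_eval_deterministic:
  "rec_eval f xs y \<Longrightarrow> rec_eval f xs z \<Longrightarrow> y = z"
proof (induction f xs y arbitrary: z rule: rec_eval.induct)
  case (Comp xs gs ys f y)
  from Comp.prems obtain ys' where *: "list_all2 (\<lambda>g y. rec_eval g xs y) gs ys'" "rec_eval f ys' z"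
    by (elim rec_evalE)
  have "ys = ys'"
    using Comp.IH(1) *(1) by (auto simp: list_all2_conv_all_nth intro!: nth_equalityI)
  then show ?case using Comp.IH(2) * by blast
next
  case (PrimRec_0 f xs y g)
  from PrimRec_0.prems have "rec_eval f xs z" by (rule rec_evalE(5))
  then show ?case by (rule PrimRec_0.IH)
next
  case (PrimRec_Suc f g n xs y y')
  from PrimRec_Suc.prems obtain w where
    "rec_eval (PrimRec f g) (n # xs) w" "rec_eval g (n # w # xs) z" by (rule rec_evalE(6))
  then show ?case using PrimRec_Suc.IH by blast
next
  case (Mu f y xs)
  from Mu.prems obtain
    z: "rec_eval f (z # xs) 0" "\<forall>i<z. \<exists>v>0. rec_eval f (i # xs) v" by (rule rec_evalE(7))
  have "\<not> z < y" using Mu.IH(2) z(1) by (metis less_irrefl)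
  moreover have "\<not> y < z"
  proof
    assume "y < z"
    then obtain v where "v > 0" "rec_eval f (y # xs) v" using z(2) by blast
    then show False using Mu.IH(1) by fastforce
  qed
  ultimately show ?case by simp
next
  case (Zero xs) then show ?case by (rule rec_evalE(1)) simp
next
  case (Succ x) then show ?case by (rule rec_evalE(2)) simp
next
  case (Proj i xs) from Proj.prems show ?case by (rule rec_evalE(3)) simp
qed


section \<open>Linear constraints\<close>

definition vecs :: "nat \<Rightarrow> real list set" where
  "vecs n = {v. length v = n}"

definition dot :: "rat list \<Rightarrow> real list \<Rightarrow> real" where
  "dot c v = sum_list (map2 (\<lambda>a x. of_rat a * x) c v)"

datatype lin_constr =
    LE "rat list" rat
  | LT "rat list" rat
  | Conj lin_constr lin_constr
  | Disj lin_constr lin_constr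

primrec constr_over :: "nat \<Rightarrow> lin_constr \<Rightarrow> bool" where
  "constr_over n (LE c d) \<longleftrightarrow> length c = n"
| "constr_over n (LT c d) \<longleftrightarrow> length c = n"
| "constr_over n (Conj F G) \<longleftrightarrow> constr_over n F \<and> constr_over n G"
| "constr_over n (Disj F G) \<longleftrightarrow> constr_over n F \<and> constr_over n G"

primrec holds :: "lin_constr \<Rightarrow> real list \<Rightarrow> bool" where
  "holds (LE c d) v \<longleftrightarrow> dot c v \<le> of_rat d"
| "holds (LT c d) v \<longleftrightarrow> dot c v < of_rat d"
| "holds (Conj F G) v \<longleftrightarrow> holds F v \<and> holds G v"
| "holds (Disj F G) v \<longleftrightarrow> holds F v \<or> holds G v"


section \<open>Memoryful neural multi-agent systems\<close>

record agent =
  act_dim :: nat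
  obs_dim :: nat
  hid_dim :: nat
  acts :: "real list set"
  obss :: "real list set"
  hids :: "real list set"
  init_hids :: "real list set"
  observe :: "real list \<Rightarrow> real list"
  policy :: "real list \<times> real list \<Rightarrow> real list \<times> real list"

record mn_mas =
  env_dim :: nat
  states :: "real list set"
  init_states :: "real list set"
  agents :: "agent list"
  trans_rel :: "real list \<Rightarrow> real list list \<Rightarrow> real list set"

definition wf_agent :: "real list set \<Rightarrow> agent \<Rightarrow> bool" where
  "wf_agent X A \<longleftrightarrow>
     acts A \<subseteq> vecs (act_dim A) \<and> obss A \<subseteq> vecs (obs_dim A) \<and> hids A \<subseteq> vecs (hid_dim A) \<and>
     init_hids A \<subseteq> hids A \<and>
     (\<forall>x\<in>X. observe A x \<in> obss A) \<and>
     (\<forall>u\<in>obss A. \<forall>h\<in>hids A. policy A (u, h) \<in> acts A \<times> hids A)"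

definition joint_acts :: "mn_mas \<Rightarrow> real list list set" where
  "joint_acts S = listset (map acts (agents S))"

definition joint_hids :: "mn_mas \<Rightarrow> real list list set" where
  "joint_hids S = listset (map hids (agents S))"

definition joint_init_hids :: "mn_mas \<Rightarrow> real list list set" where
  "joint_init_hids S = listset (map init_hids (agents S))"

definition joint_observe :: "mn_mas \<Rightarrow> real list \<Rightarrow> real list list" where
  "joint_observe S x = map (\<lambda>A. observe A x) (agents S)"

definition joint_policy ::
  "mn_mas \<Rightarrow> real list list \<Rightarrow> real list list \<Rightarrow> real list list \<times> real list list" where
  "joint_policy S us hs =
     (let res = map2 policy (agents S) (zip us hs) in (map fst res, map snd res))"

definition wf_mn_mas :: "mn_mas \<Rightarrow> bool" where
  "wf_mn_mas S \<longleftrightarrow>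
     states S \<subseteq> vecs (env_dim S) \<and> init_states S \<subseteq> states S \<and>
     agents S \<noteq> [] \<and> (\<forall>A\<in>set (agents S). wf_agent (states S) A) \<and>
     (\<forall>x\<in>states S. \<forall>as\<in>joint_acts S. trans_rel S x as \<subseteq> states S)"

definition is_path :: "mn_mas \<Rightarrow> (nat \<Rightarrow> real list) \<Rightarrow> (nat \<Rightarrow> real list list) \<Rightarrow> bool" where
  "is_path S x h \<longleftrightarrow>
     (\<forall>t. x t \<in> states S \<and> h t \<in> joint_hids S \<and>
       (\<exists>as. (as, h (Suc t)) = joint_policy S (joint_observe S (x t)) (h t) \<and>
             x (Suc t) \<in> trans_rel S (x t) as))"


section \<open>The specification language\<close>

datatype ltl =
    Atom "rat list" rat
  | Neg ltl
  | And ltl ltl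
  | Or ltl ltl
  | Next ltl
  | Until ltl ltl
  | Release ltl ltl
  | Always ltl
  | Eventually ltl

primrec ltl_over :: "nat \<Rightarrow> ltl \<Rightarrow> bool" where
  "ltl_over m (Atom c d) \<longleftrightarrow> length c = m"
| "ltl_over m (Neg \<phi>) \<longleftrightarrow> ltl_over m \<phi>"
| "ltl_over m (And \<phi> \<psi>) \<longleftrightarrow> ltl_over m \<phi> \<and> ltl_over m \<psi>"
| "ltl_over m (Or \<phi> \<psi>) \<longleftrightarrow> ltl_over m \<phi> \<and> ltl_over m \<psi>"
| "ltl_over m (Next \<phi>) \<longleftrightarrow> ltl_over m \<phi>"
| "ltl_over m (Until \<phi> \<psi>) \<longleftrightarrow> ltl_over m \<phi> \<and> ltl_over m \<psi>"
| "ltl_over m (Release \<phi> \<psi>) \<longleftrightarrow> ltl_over m \<phi> \<and> ltl_over m \<psi>"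
| "ltl_over m (Always \<phi>) \<longleftrightarrow> ltl_over m \<phi>"
| "ltl_over m (Eventually \<phi>) \<longleftrightarrow> ltl_over m \<phi>"

primrec sat_at :: "(nat \<Rightarrow> real list) \<Rightarrow> nat \<Rightarrow> ltl \<Rightarrow> bool" where
  "sat_at x t (Atom c d) \<longleftrightarrow> dot c (x t) \<le> of_rat d"
| "sat_at x t (Neg \<phi>) \<longleftrightarrow> \<not> sat_at x t \<phi>"
| "sat_at x t (And \<phi> \<psi>) \<longleftrightarrow> sat_at x t \<phi> \<and> sat_at x t \<psi>"
| "sat_at x t (Or \<phi> \<psi>) \<longleftrightarrow> sat_at x t \<phi> \<or> sat_at x t \<psi>"
| "sat_at x t (Next \<phi>) \<longleftrightarrow> sat_at x (t + 1) \<phi>"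
| "sat_at x t (Until \<psi> \<phi>) \<longleftrightarrow> (\<exists>i. sat_at x (t + i) \<phi> \<and> (\<forall>j<i. sat_at x (t + j) \<psi>))"
| "sat_at x t (Release \<psi> \<phi>) \<longleftrightarrow>
     (\<forall>i. sat_at x (t + i) \<phi>) \<or> (\<exists>i. sat_at x (t + i) \<psi> \<and> (\<forall>j\<le>i. sat_at x (t + j) \<phi>))"
| "sat_at x t (Always \<phi>) \<longleftrightarrow> (\<forall>i. sat_at x (t + i) \<phi>)"
| "sat_at x t (Eventually \<phi>) \<longleftrightarrow> (\<exists>i. sat_at x (t + i) \<phi>)"

definition satisfies :: "mn_mas \<Rightarrow> ltl \<Rightarrow> bool" (infix \<open>\<Turnstile>\<close> 50) where
  "S \<Turnstile> \<phi> \<longleftrightarrow>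
     (\<forall>x h. is_path S x h \<and> x 0 \<in> init_states S \<and> h 0 \<in> joint_init_hids S \<longrightarrow> sat_at x 0 \<phi>)"


section \<open>Linear definability\<close>

text \<open>
  A description lists the dimensions together with constraints for the initial sets and for the
  graphs of the observation functions, the policies and the transition relation.  The arguments
  and values of each graph are concatenated into one vector.
\<close>

record agent_desc =
  d_act_dim :: nat
  d_obs_dim :: nat
  d_hid_dim :: nat
  d_init_hids :: lin_constr
  d_observe :: lin_constr
  d_policy :: lin_constr

record mas_desc =
  d_env_dim :: nat
  d_init_states :: lin_constr
  d_agents :: "agent_desc list"
  d_trans :: lin_constr

text \<open>
  The spaces of states, actions, observations and hidden states need not be linearly definable.
  The constraints only have to be right on the domains of the maps they express, and
  \<open>linearly_defines_determines\<close> below shows that this already fixes which formulae are satisfied.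
\<close>

definition agent_linearly_defines :: "nat \<Rightarrow> real list set \<Rightarrow> agent_desc \<Rightarrow> agent \<Rightarrow> bool" where
  "agent_linearly_defines m X D A \<longleftrightarrow>
     d_act_dim D = act_dim A \<and> d_obs_dim D = obs_dim A \<and> d_hid_dim D = hid_dim A \<and>
     constr_over (hid_dim A) (d_init_hids D) \<and>
     init_hids A = {h \<in> vecs (hid_dim A). holds (d_init_hids D) h} \<and>
     constr_over (m + obs_dim A) (d_observe D) \<and>
     (\<forall>x\<in>X. \<forall>u\<in>vecs (obs_dim A). holds (d_observe D) (x @ u) \<longleftrightarrow> observe A x = u) \<and>
     constr_over (obs_dim A + hid_dim A + act_dim A + hid_dim A) (d_policy D) \<and>
     (\<forall>u\<in>obss A. \<forall>h\<in>hids A. \<forall>a\<in>vecs (act_dim A). \<forall>h'\<in>vecs (hid_dim A).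
        holds (d_policy D) (u @ h @ a @ h') \<longleftrightarrow> policy A (u, h) = (a, h'))"

definition linearly_defines :: "mas_desc \<Rightarrow> mn_mas \<Rightarrow> bool" where
  "linearly_defines D S \<longleftrightarrow>
     d_env_dim D = env_dim S \<and>
     constr_over (env_dim S) (d_init_states D) \<and>
     init_states S = {x \<in> vecs (env_dim S). holds (d_init_states D) x} \<and>
     list_all2 (agent_linearly_defines (env_dim S) (states S)) (d_agents D) (agents S) \<and>
     constr_over (env_dim S + (\<Sum>A\<leftarrow>agents S. act_dim A) + env_dim S) (d_trans D) \<and>
     (\<forall>x\<in>states S. \<forall>as\<in>joint_acts S. \<forall>x'\<in>vecs (env_dim S).
        holds (d_trans D) (x @ concat as @ x') \<longleftrightarrow> x' \<in> trans_rel S x as)"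

lemma mem_listset_iff: "xs \<in> listset As \<longleftrightarrow> list_all2 (\<in>) xs As"
proof (induction As arbitrary: xs)
  case (Cons A As)
  then show ?case by (auto simp: set_Cons_def list_all2_Cons2)
qed simp

lemma mem_listset_map_iff:
  "xs \<in> listset (map f As) \<longleftrightarrow> length xs = length As \<and> (\<forall>i<length As. xs ! i \<in> f (As ! i))"
  by (auto simp: mem_listset_iff list_all2_conv_all_nth)

lemma linearly_defines_path:
  assumes S: "wf_mn_mas S" "linearly_defines D S"
    and S': "wf_mn_mas S'" "linearly_defines D S'"
    and path: "is_path S x h" and x0: "x 0 \<in> init_states S" and h0: "h 0 \<in> joint_init_hids S"
  shows "is_path S' x h \<and> x 0 \<in> init_states S' \<and> h 0 \<in> joint_init_hids S'"
proof -
  define n where "n = length (agents S)"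
  have dim: "env_dim S' = env_dim S"
    using S(2) S'(2) by (simp add: linearly_defines_def)
  have "length (d_agents D) = length (agents S)" "length (d_agents D) = length (agents S')"
    using S(2) S'(2) unfolding linearly_defines_def by (blast dest: list_all2_lengthD)+
  then have len: "length (agents S') = n" "length (d_agents D) = n"
    by (simp_all add: n_def)
  have ag: "agent_linearly_defines (env_dim S) (states S) (d_agents D ! i) (agents S ! i)"
    "agent_linearly_defines (env_dim S) (states S') (d_agents D ! i) (agents S' ! i)"
    "wf_agent (states S) (agents S ! i)" "wf_agent (states S') (agents S' ! i)"
    if "i < n" for i
    using S S' that len dim
    by (auto simp: linearly_defines_def wf_mn_mas_def list_all2_conv_all_nth n_def)
  have x0': "x 0 \<in> init_states S'"
    using x0 S(2) S'(2) dim by (simp add: linearly_defines_def)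
  have "init_hids (agents S' ! i) = init_hids (agents S ! i)" if "i < n" for i
    using ag(1,2)[OF that] by (simp add: agent_linearly_defines_def)
  then have h0': "h 0 \<in> joint_init_hids S'"
    using h0 len
    by (auto simp: joint_init_hids_def mem_listset_map_iff n_def)
  have hl: "length (h t) = n" "i < n \<Longrightarrow> h t ! i \<in> hids (agents S ! i)" for t i
    using path by (simp_all add: is_path_def joint_hids_def mem_listset_map_iff n_def)
  have xs: "x t \<in> states S" for t
    using path by (auto simp: is_path_def)
  have step: "x (Suc t) \<in> states S' \<and> h (Suc t) \<in> joint_hids S' \<and>
      (\<exists>as. (as, h (Suc t)) = joint_policy S' (joint_observe S' (x t)) (h t) \<and>
             x (Suc t) \<in> trans_rel S' (x t) as)"
    if xt: "x t \<in> states S'" and ht: "h t \<in> joint_hids S'" for t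
  proof -
    have hl': "i < n \<Longrightarrow> h t ! i \<in> hids (agents S' ! i)" for i
      using ht len by (auto simp: joint_hids_def mem_listset_map_iff)
    obtain as where as: "(as, h (Suc t)) = joint_policy S (joint_observe S (x t)) (h t)"
      "x (Suc t) \<in> trans_rel S (x t) as"
      using path by (auto simp: is_path_def)
    have obs: "observe (agents S' ! i) (x t) = observe (agents S ! i) (x t)" if "i < n" for i
    proof -
      let ?u = "observe (agents S ! i) (x t)"
      have "?u \<in> vecs (obs_dim (agents S ! i))"
        using ag(3)[OF that] xs by (auto simp: wf_agent_def)
      moreover from this have "holds (d_observe (d_agents D ! i)) (x t @ ?u)"
        using ag(1)[OF that] xs by (auto simp: agent_linearly_defines_def)
      ultimately show ?thesis
        using ag(1,2)[OF that] xt by (auto simp: agent_linearly_defines_def)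
    qed
    have pol: "policy (agents S' ! i) (observe (agents S' ! i) (x t), h t ! i)
             = policy (agents S ! i) (observe (agents S ! i) (x t), h t ! i)"
      (is "_ = policy _ (?u, ?h)")
      and pol_in: "policy (agents S ! i) (observe (agents S ! i) (x t), h t ! i)
             \<in> acts (agents S ! i) \<times> hids (agents S ! i)"
      and pol_in': "policy (agents S' ! i) (observe (agents S' ! i) (x t), h t ! i)
             \<in> acts (agents S' ! i) \<times> hids (agents S' ! i)"
      if "i < n" for i
    proof -
      let ?A = "agents S ! i" and ?A' = "agents S' ! i"
      have u: "?u \<in> obss ?A" "?u \<in> obss ?A'"
        using ag(3,4)[OF that] xs xt obs[OF that] by (auto simp: wf_agent_def)
      obtain a h' where p: "policy ?A (?u, ?h) = (a, h')" by fastforce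
      show in1: "policy ?A (?u, ?h) \<in> acts ?A \<times> hids ?A"
        using ag(3)[OF that] u hl(2)[OF that] unfolding wf_agent_def by blast
      show "policy ?A' (observe ?A' (x t), ?h) \<in> acts ?A' \<times> hids ?A'"
        using ag(4)[OF that] u hl'[OF that] obs[OF that] unfolding wf_agent_def by metis
      have v: "a \<in> vecs (act_dim ?A)" "h' \<in> vecs (hid_dim ?A)"
        using in1 p ag(3)[OF that] by (auto simp: wf_agent_def)
      then have "holds (d_policy (d_agents D ! i)) (?u @ ?h @ a @ h')"
        using ag(1)[OF that] u hl(2)[OF that] p by (auto simp: agent_linearly_defines_def)
      then have "policy ?A' (?u, ?h) = (a, h')"
        using ag(1,2)[OF that] u hl'[OF that] v by (auto simp: agent_linearly_defines_def)
      then show "policy ?A' (observe ?A' (x t), ?h) = policy ?A (?u, ?h)"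
        using p obs[OF that] by simp
    qed
    have jp: "joint_policy S' (joint_observe S' (x t)) (h t)
        = joint_policy S (joint_observe S (x t)) (h t)"
      using pol len hl(1)[of t]
      by (auto simp: joint_policy_def joint_observe_def Let_def n_def intro!: nth_equalityI)
    have "as \<in> joint_acts S"
      using as(1) pol_in hl(1)[of t]
      by (auto simp: joint_acts_def mem_listset_map_iff joint_policy_def
          joint_observe_def Let_def n_def mem_Times_iff)
    moreover have as': "as \<in> joint_acts S'" "h (Suc t) \<in> joint_hids S'"
      using as(1) pol_in' hl(1)[of t] len unfolding jp[symmetric]
      by (auto simp: joint_acts_def joint_hids_def mem_listset_map_iff
          joint_policy_def joint_observe_def Let_def n_def mem_Times_iff)
    moreover have "x (Suc t) \<in> vecs (env_dim S)"
      using xs S(1) by (auto simp: wf_mn_mas_def)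
    ultimately have "x (Suc t) \<in> trans_rel S' (x t) as"
      using S(2) S'(2) xs xt as(2) dim unfolding linearly_defines_def by metis
    moreover from this have "x (Suc t) \<in> states S'"
      using S'(1) xt as' unfolding wf_mn_mas_def by blast
    ultimately show ?thesis using as' as(1) jp by metis
  qed
  have "x t \<in> states S' \<and> h t \<in> joint_hids S'" for t
  proof (induction t)
    case 0
    have "init_hids (agents S' ! i) \<subseteq> hids (agents S' ! i)" if "i < n" for i
      using ag(4)[OF that] by (simp add: wf_agent_def)
    then show ?case using x0' h0' S'(1) len
      by (auto simp: wf_mn_mas_def joint_init_hids_def joint_hids_def mem_listset_map_iff)
  qed (use step in blast)
  then show ?thesis using step x0' h0' unfolding is_path_def by blast
qed

lemma linearly_defines_determines:
  assumes "wf_mn_mas S" "linearly_defines D S" "wf_mn_mas S'" "linearly_defines D S'"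
  shows "S \<Turnstile> \<phi> \<longleftrightarrow> S' \<Turnstile> \<phi>"
  using linearly_defines_path[OF assms] linearly_defines_path[OF assms(3,4,1,2)]
  unfolding satisfies_def by blast


section \<open>Encoding of problem instances as numbers\<close>

definition encode_rat :: "rat \<Rightarrow> nat" where
  "encode_rat q = (case quotient_of q of (a, b) \<Rightarrow> prod_encode (int_encode a, int_encode b))"

definition encode_rats :: "rat list \<Rightarrow> nat" where
  "encode_rats c = list_encode (map encode_rat c)"

primrec encode_constr :: "lin_constr \<Rightarrow> nat" where
  "encode_constr (LE c d) = list_encode [0, encode_rats c, encode_rat d]"
| "encode_constr (LT c d) = list_encode [1, encode_rats c, encode_rat d]"
| "encode_constr (Conj F G) = list_encode [2, encode_constr F, encode_constr G]"
| "encode_constr (Disj F G) = list_encode [3, encode_constr F, encode_constr G]"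

primrec encode_ltl :: "ltl \<Rightarrow> nat" where
  "encode_ltl (Atom c d) = list_encode [0, encode_rats c, encode_rat d]"
| "encode_ltl (Neg \<phi>) = list_encode [1, encode_ltl \<phi>]"
| "encode_ltl (And \<phi> \<psi>) = list_encode [2, encode_ltl \<phi>, encode_ltl \<psi>]"
| "encode_ltl (Or \<phi> \<psi>) = list_encode [3, encode_ltl \<phi>, encode_ltl \<psi>]"
| "encode_ltl (Next \<phi>) = list_encode [4, encode_ltl \<phi>]"
| "encode_ltl (Until \<phi> \<psi>) = list_encode [5, encode_ltl \<phi>, encode_ltl \<psi>]"
| "encode_ltl (Release \<phi> \<psi>) = list_encode [6, encode_ltl \<phi>, encode_ltl \<psi>]"
| "encode_ltl (Always \<phi>) = list_encode [7, encode_ltl \<phi>]"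
| "encode_ltl (Eventually \<phi>) = list_encode [8, encode_ltl \<phi>]"

definition encode_agent :: "agent_desc \<Rightarrow> nat" where
  "encode_agent D = list_encode
     [d_act_dim D, d_obs_dim D, d_hid_dim D,
      encode_constr (d_init_hids D), encode_constr (d_observe D), encode_constr (d_policy D)]"

definition encode_mas :: "mas_desc \<Rightarrow> nat" where
  "encode_mas D = list_encode
     [d_env_dim D, encode_constr (d_init_states D),
      list_encode (map encode_agent (d_agents D)), encode_constr (d_trans D)]"

definition encode_instance :: "mas_desc \<Rightarrow> ltl \<Rightarrow> nat" where
  "encode_instance D \<phi> = prod_encode (encode_mas D, encode_ltl \<phi>)"

lemma encode_rat_inject: "encode_rat p = encode_rat q \<longleftrightarrow> p = q"
  by (auto simp: encode_rat_def prod_encode_eq int_encode_eq split: prod.splits intro: quotient_of_inject)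

lemma encode_rats_inject: "encode_rats c = encode_rats d \<longleftrightarrow> c = d"
  by (simp add: encode_rats_def list_encode_eq inj_map_eq_map inj_def encode_rat_inject)

lemma encode_constr_inject: "encode_constr F = encode_constr G \<longleftrightarrow> F = G"
proof (induction F arbitrary: G)
  case (LE c d) show ?case
    by (cases G) (simp_all del: list_encode.simps add: list_encode_eq encode_rat_inject encode_rats_inject)
next
  case (LT c d) show ?case
    by (cases G) (simp_all del: list_encode.simps add: list_encode_eq encode_rat_inject encode_rats_inject)
next
  case (Conj F1 F2) then show ?case by (cases G) (simp_all del: list_encode.simps add: list_encode_eq)
next
  case (Disj F1 F2) then show ?case by (cases G) (simp_all del: list_encode.simps add: list_encode_eq)
qed

lemma encode_ltl_inject: "encode_ltl \<phi> = encode_ltl \<psi> \<longleftrightarrow> \<phi> = \<psi>"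
proof (induction \<phi> arbitrary: \<psi>)
  case (Atom c d) show ?case
    by (cases \<psi>) (simp_all del: list_encode.simps add: list_encode_eq encode_rat_inject encode_rats_inject)
next
  case (Neg \<phi>) then show ?case by (cases \<psi>) (simp_all del: list_encode.simps add: list_encode_eq)
next
  case (And \<phi>1 \<phi>2) then show ?case by (cases \<psi>) (simp_all del: list_encode.simps add: list_encode_eq)
next
  case (Or \<phi>1 \<phi>2) then show ?case by (cases \<psi>) (simp_all del: list_encode.simps add: list_encode_eq)
next
  case (Next \<phi>) then show ?case by (cases \<psi>) (simp_all del: list_encode.simps add: list_encode_eq)
next
  case (Until \<phi>1 \<phi>2) then show ?case by (cases \<psi>) (simp_all del: list_encode.simps add: list_encode_eq)
next
  case (Release \<phi>1 \<phi>2) then show ?case by (cases \<psi>) (simp_all del: list_encode.simps add: list_encode_eq)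
next
  case (Always \<phi>) then show ?case by (cases \<psi>) (simp_all del: list_encode.simps add: list_encode_eq)
next
  case (Eventually \<phi>) then show ?case by (cases \<psi>) (simp_all del: list_encode.simps add: list_encode_eq)
qed

lemma encode_agent_inject: "encode_agent D = encode_agent D' \<longleftrightarrow> D = D'"
  by (cases D; cases D')
    (simp del: list_encode.simps add: list_encode_eq encode_agent_def encode_constr_inject)

lemma encode_mas_inject: "encode_mas D = encode_mas D' \<longleftrightarrow> D = D'"
  by (cases D; cases D')
    (simp del: list_encode.simps add: list_encode_eq encode_mas_def encode_constr_inject inj_map_eq_map inj_def
      encode_agent_inject)

lemma encode_instance_inject:
  "encode_instance D \<phi> = encode_instance D' \<psi> \<longleftrightarrow> D = D' \<and> \<phi> = \<psi>"
  by (simp add: encode_instance_def prod_encode_eq encode_mas_inject encode_ltl_inject)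

end

theory Submission
  imports Defs
begin

text \<open>
  The proof is a diagonal argument. Every partial recursive function is computed by a
  nondeterministic register program, and the control flow graph of such a program is the transition
  relation of a system whose only agent does nothing: one coordinate of the environment state is the
  label, the others are the registers. Stuttering steps make every finite run extend to a path, so
  a safety formula expresses that the exit is not reached with a given value of register \<open>0\<close>.
  Given a decision procedure \<open>f\<close>, consider the program that guesses a number \<open>n\<close>, runs \<open>f\<close> on the
  instance consisting of the system with code \<open>n + 1\<close> and the formula that the exit is not reached
  with value \<open>n + 1\<close>, and reaches the exit with value \<open>n + 1\<close> iff \<open>f\<close> answers \<open>1\<close>. If \<open>n + 1\<close> is
  the code of this very program, then the answer of \<open>f\<close> is wrong.
\<close>

section \<open>Nondeterministic register programs\<close>

text \<open>Each action amounts to a system of linear equations in the old and new register values.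
  There are no conditionals: branching and loop exits come from the nondeterminism of
  \<open>Star\<close> combined with tests that block the wrong runs.\<close>

datatype act = Assign nat "nat list" nat | Test nat "nat list" nat

datatype prog = Act act | Seq prog prog | Star prog

type_synonym store = "nat \<Rightarrow> nat"

primrec act_rel :: "act \<Rightarrow> (store \<times> store) set" where
  "act_rel (Assign r qs c) = {(s, s'). s' = s(r := sum_list (map s qs) + c)}"
| "act_rel (Test r qs c) = {(s, s'). s' = s \<and> s r = sum_list (map s qs) + c}"

primrec prog_rel :: "prog \<Rightarrow> (store \<times> store) set" where
  "prog_rel (Act a) = act_rel a"
| "prog_rel (Seq P Q) = prog_rel P O prog_rel Q"
| "prog_rel (Star P) = (prog_rel P)\<^sup>*"

primrec act_regs :: "act \<Rightarrow> nat set" where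
  "act_regs (Assign r qs c) = insert r (set qs)"
| "act_regs (Test r qs c) = insert r (set qs)"

primrec prog_regs :: "prog \<Rightarrow> nat set" where
  "prog_regs (Act a) = act_regs a"
| "prog_regs (Seq P Q) = prog_regs P \<union> prog_regs Q"
| "prog_regs (Star P) = prog_regs P"

declare prog_rel.simps(2) [simp del]

lemma prog_rel_Seq_iff [simp]:
  "(s, s') \<in> prog_rel (Seq P Q) \<longleftrightarrow> (\<exists>u. (s, u) \<in> prog_rel P \<and> (u, s') \<in> prog_rel Q)"
  by (auto simp: prog_rel.simps(2))

text \<open>The iterated increment is how a program guesses a number: the input in
  \<open>diagonal_prog\<close> and a positive value in \<open>implementable_Mu\<close>.\<close>

lemma prog_rel_count_up_iff:
  "(s, s') \<in> prog_rel (Star (Act (Assign r [r] 1))) \<longleftrightarrow> (\<exists>m. s' = s(r := s r + m))"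
proof
  assume "(s, s') \<in> prog_rel (Star (Act (Assign r [r] 1)))"
  then have "(s, s') \<in> (prog_rel (Act (Assign r [r] 1)))\<^sup>*" by simp
  then show "\<exists>m. s' = s(r := s r + m)"
  proof (induction rule: rtrancl_induct)
    case base
    have "s = s(r := s r + 0)" by simp
    then show ?case by blast
  next
    case (step u u')
    then obtain m where "u = s(r := s r + m)" by blast
    with step.hyps(2) have "u' = s(r := s r + Suc m)" by simp
    then show ?case by blast
  qed
next
  have "(s, s(r := s r + m)) \<in> (prog_rel (Act (Assign r [r] 1)))\<^sup>*" for m
  proof (induction m)
    case (Suc m)
    have "(s(r := s r + m), s(r := s r + Suc m)) \<in> prog_rel (Act (Assign r [r] 1))" by simp
    with Suc show ?case by (rule rtrancl_into_rtrancl)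
  qed simp
  then show "\<exists>m. s' = s(r := s r + m) \<Longrightarrow> (s, s') \<in> prog_rel (Star (Act (Assign r [r] 1)))"
    by auto
qed

section \<open>Compilation of partial recursive functions\<close>

text \<open>
  Runs that cannot produce a value are blocked by a test, so an undefined value of \<open>g\<close> corresponds
  to the absence of a final store.
\<close>

definition implements :: "prog \<Rightarrow> nat \<Rightarrow> nat \<Rightarrow> nat list \<Rightarrow> nat \<Rightarrow> recf \<Rightarrow> bool" where
  "implements P n k xs r g \<longleftrightarrow>
     n \<le> k \<and> prog_regs P \<subseteq> {..<k} \<and>
     (\<forall>s s'. (s, s') \<in> prog_rel P \<longrightarrow>
        rec_eval g (map s xs) (s' r) \<and> (\<forall>i<n. i \<noteq> r \<longrightarrow> s' i = s i)) \<and>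
     (\<forall>s y. rec_eval g (map s xs) y \<longrightarrow> (\<exists>s'. (s, s') \<in> prog_rel P \<and> s' r = y))"

lemma implementsD:
  assumes "implements P n k xs r g"
  shows "n \<le> k" "prog_regs P \<subseteq> {..<k}"
    "(s, s') \<in> prog_rel P \<Longrightarrow> rec_eval g (map s xs) (s' r)"
    "(s, s') \<in> prog_rel P \<Longrightarrow> i < n \<Longrightarrow> i \<noteq> r \<Longrightarrow> s' i = s i"
    "rec_eval g (map s xs) y \<Longrightarrow> \<exists>s'. (s, s') \<in> prog_rel P \<and> s' r = y"
  using assms unfolding implements_def by blast+

text \<open>The programs run one after the other. Below \<open>n\<close> each changes only its own
  target, and the targets are distinct and disjoint from the arguments, so later programs still read
  the original arguments and keep the earlier results.\<close>

lemma implementable_list: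
  assumes "\<And>g r. g \<in> set gs \<Longrightarrow> r < n \<Longrightarrow> \<exists>P k. implements P n k xs r g"
    and "length ts = length gs" "distinct ts" "set ts \<subseteq> {..<n}" "set xs \<subseteq> {..<n}"
    and "set ts \<inter> set xs = {}" "n > 0"
  shows "\<exists>P k. n \<le> k \<and> prog_regs P \<subseteq> {..<k} \<and>
     (\<forall>s s'. (s, s') \<in> prog_rel P \<longrightarrow>
        list_all2 (\<lambda>g y. rec_eval g (map s xs) y) gs (map s' ts) \<and>
        (\<forall>i<n. i \<notin> set ts \<longrightarrow> s' i = s i)) \<and>
     (\<forall>s ys. list_all2 (\<lambda>g y. rec_eval g (map s xs) y) gs ys \<longrightarrow>
        (\<exists>s'. (s, s') \<in> prog_rel P \<and> map s' ts = ys))"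
  using assms
proof (induction gs arbitrary: ts)
  case Nil
  \<comment> \<open>A test that always succeeds serves as the empty program; \<open>n > 0\<close>
    keeps register \<open>0\<close> below the bound.\<close>
  show ?case
    by (rule exI[of _ "Act (Test 0 [0] 0)"], rule exI[of _ n]) (use Nil in auto)
next
  case (Cons g gs)
  from Cons.prems(2) obtain t ts' where ts: "ts = t # ts'" by (cases ts) auto
  obtain P k where P: "implements P n k xs t g"
    using Cons.prems(1)[of g t] Cons.prems(4) ts by auto
  obtain Q l where Q: "n \<le> l" "prog_regs Q \<subseteq> {..<l}"
    "\<And>s s'. (s, s') \<in> prog_rel Q \<Longrightarrow>
        list_all2 (\<lambda>g y. rec_eval g (map s xs) y) gs (map s' ts') \<and>
        (\<forall>i<n. i \<notin> set ts' \<longrightarrow> s' i = s i)"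
    "\<And>s ys. list_all2 (\<lambda>g y. rec_eval g (map s xs) y) gs ys \<Longrightarrow>
        \<exists>s'. (s, s') \<in> prog_rel Q \<and> map s' ts' = ys"
    using Cons.IH[of ts'] Cons.prems ts by auto
  have t: "t < n" "t \<notin> set ts'" "t \<notin> set xs" using Cons.prems ts by auto
  have args: "map u xs = map s xs" if "(s, u) \<in> prog_rel P" for s u
    using implementsD(4)[OF P that] t Cons.prems(5) by (auto simp: subset_iff)
  show ?case
  proof (rule exI[of _ "Seq P Q"], rule exI[of _ "max k l"], intro conjI allI impI)
    show "n \<le> max k l" "prog_regs (Seq P Q) \<subseteq> {..<max k l}"
      using implementsD(1,2)[OF P] Q(1,2) by auto
  next
    fix s s' assume "(s, s') \<in> prog_rel (Seq P Q)"
    then obtain u where u: "(s, u) \<in> prog_rel P" "(u, s') \<in> prog_rel Q"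
      by auto
    have "s' t = u t" using Q(3)[OF u(2)] t by blast
    then show "list_all2 (\<lambda>g y. rec_eval g (map s xs) y) (g # gs) (map s' ts)"
      using Q(3)[OF u(2)] implementsD(3)[OF P u(1)] args[OF u(1)] ts by simp
    fix i assume "i < n" "i \<notin> set ts"
    then show "s' i = s i"
      using Q(3)[OF u(2)] implementsD(4)[OF P u(1), of i] ts by auto
  next
    fix s zs assume "list_all2 (\<lambda>g y. rec_eval g (map s xs) y) (g # gs) zs"
    then obtain y ys where zs: "zs = y # ys" "rec_eval g (map s xs) y"
      "list_all2 (\<lambda>g y. rec_eval g (map s xs) y) gs ys"
      by (auto simp: list_all2_Cons1)
    from implementsD(5)[OF P zs(2)] obtain u where u: "(s, u) \<in> prog_rel P" "u t = y" by blast
    from Q(4)[of u ys] obtain s' where s': "(u, s') \<in> prog_rel Q" "map s' ts' = ys"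
      using zs(3) args[OF u(1)] by auto
    have "s' t = u t" using Q(3)[OF s'(1)] t by blast
    then show "\<exists>s'. (s, s') \<in> prog_rel (Seq P Q) \<and> map s' ts = zs"
      using u s' zs(1) ts by auto
  qed
qed

text \<open>The test compares a register with its own successor and blocks every run. This covers
  the arities at which a function has no value.\<close>

lemma implements_fail:
  assumes "r < n" "\<And>s y. \<not> rec_eval g (map s xs) y"
  shows "implements (Act (Test r [r] 1)) n n xs r g"
  using assms by (auto simp: implements_def)

text \<open>The intermediate values go to the fresh registers from \<open>n\<close> to
  \<open>N - 1\<close>. Implementing the parts relative to \<open>N\<close> instead of
  \<open>n\<close> forces their scratch registers beyond these.\<close>

lemma implementable_Comp:
  assumes f: "\<And>xs r n. set xs \<subseteq> {..<n} \<Longrightarrow> r < n \<Longrightarrow> \<exists>P k. implements P n k xs r f"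
    and gs: "\<And>g xs r n. g \<in> set gs \<Longrightarrow> set xs \<subseteq> {..<n} \<Longrightarrow> r < n \<Longrightarrow> \<exists>P k. implements P n k xs r g"
    and xs: "set xs \<subseteq> {..<n}" and r: "r < n"
  shows "\<exists>P k. implements P n k xs r (Comp f gs)"
proof -
  define N where "N = n + length gs"
  define ts where "ts = [n..<N]"
  have xsN: "set xs \<subseteq> {..<N}" and disj: "set ts \<inter> set xs = {}"
    and len: "length ts = length gs" and ts: "distinct ts" "set ts \<subseteq> {..<N}"
    using xs by (auto simp: N_def ts_def)
  obtain Q l where Q: "N \<le> l" "prog_regs Q \<subseteq> {..<l}"
    "\<And>s s'. (s, s') \<in> prog_rel Q \<Longrightarrow>
        list_all2 (\<lambda>g y. rec_eval g (map s xs) y) gs (map s' ts) \<and>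
        (\<forall>i<N. i \<notin> set ts \<longrightarrow> s' i = s i)"
    "\<And>s ys. list_all2 (\<lambda>g y. rec_eval g (map s xs) y) gs ys \<Longrightarrow>
        \<exists>s'. (s, s') \<in> prog_rel Q \<and> map s' ts = ys"
    using implementable_list[OF gs[OF _ xsN] len ts xsN disj] r by (auto simp: N_def)
  obtain P k where P: "implements P N k ts r f"
    using f[OF ts(2), of r] r by (auto simp: N_def)
  have "implements (Seq Q P) n (max k l) xs r (Comp f gs)"
    unfolding implements_def
  proof (intro conjI allI impI)
    show "n \<le> max k l" "prog_regs (Seq Q P) \<subseteq> {..<max k l}"
      using implementsD(1,2)[OF P] Q(1,2) by (auto simp: N_def)
  next
    fix s s' assume "(s, s') \<in> prog_rel (Seq Q P)"
    then obtain u where u: "(s, u) \<in> prog_rel Q" "(u, s') \<in> prog_rel P" by auto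
    show "rec_eval (Comp f gs) (map s xs) (s' r)"
      using Q(3)[OF u(1)] implementsD(3)[OF P u(2)] by (blast intro: rec_eval.Comp)
    fix i assume "i < n" "i \<noteq> r"
    then show "s' i = s i"
      using Q(3)[OF u(1)] implementsD(4)[OF P u(2), of i] by (auto simp: ts_def N_def)
  next
    fix s y assume "rec_eval (Comp f gs) (map s xs) y"
    then obtain ys where ys: "list_all2 (\<lambda>g y. rec_eval g (map s xs) y) gs ys" "rec_eval f ys y"
      by (elim rec_evalE)
    from Q(4)[OF ys(1)] obtain u where u: "(s, u) \<in> prog_rel Q" "map u ts = ys" by blast
    from implementsD(5)[OF P, of u y] obtain s' where "(u, s') \<in> prog_rel P" "s' r = y"
      using ys(2) u(2) by blast
    then show "\<exists>s'. (s, s') \<in> prog_rel (Seq Q P) \<and> s' r = y" using u(1) by auto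
  qed
  then show ?thesis by blast
qed

text \<open>The loop \<open>Star B\<close> makes any number of rounds with counter \<open>i\<close>
  and accumulator \<open>w\<close>; the test against \<open>a\<close> discards the runs with a wrong
  number of rounds. Register \<open>r\<close> is written last because it may be one of the
  arguments.\<close>

lemma implementable_PrimRec:
  assumes f: "\<And>xs r n. set xs \<subseteq> {..<n} \<Longrightarrow> r < n \<Longrightarrow> \<exists>P k. implements P n k xs r f"
    and g: "\<And>xs r n. set xs \<subseteq> {..<n} \<Longrightarrow> r < n \<Longrightarrow> \<exists>P k. implements P n k xs r g"
    and xs: "set xs \<subseteq> {..<n}" and r: "r < n"
  shows "\<exists>P k. implements P n k xs r (PrimRec f g)"
proof (cases xs)
  case Nil
  have "\<not> rec_eval (PrimRec f g) (map s xs) y" for s y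
    using Nil by (auto elim: rec_eval.cases)
  then show ?thesis using implements_fail r by blast
next
  case (Cons a ys)
  define i w v N where "i = n" and "w = n + 1" and "v = n + 2" and "N = n + 3"
  note defs = i_def w_def v_def N_def
  have a: "a < n" and ys: "set ys \<subseteq> {..<n}" using xs Cons by auto
  have ysN: "set ys \<subseteq> {..<N}" using ys by (auto simp: defs)
  obtain F k where F: "implements F N k ys w f"
    using f[of ys N w] ysN by (auto simp: defs)
  obtain G l where G: "implements G N l (i # w # ys) v g"
    using g[of "i # w # ys" N v] ysN by (auto simp: defs)
  define B where "B = Seq G (Seq (Act (Assign w [v] 0)) (Act (Assign i [i] 1)))"
  define P where "P = Seq F (Seq (Act (Assign i [] 0)) (Seq (Star B)
    (Seq (Act (Test i [a] 0)) (Act (Assign r [w] 0)))))"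
  have B_sound: "rec_eval g (s i # s w # map s ys) (s' w) \<and> s' i = Suc (s i) \<and> (\<forall>j<n. s' j = s j)"
    if "(s, s') \<in> prog_rel B" for s s'
  proof -
    from that obtain u where u: "(s, u) \<in> prog_rel G" "s' = u(w := u v, i := Suc (u i))"
      by (auto simp: B_def defs)
    show ?thesis
      using implementsD(3)[OF G u(1)] implementsD(4)[OF G u(1)] u(2) by (auto simp: defs)
  qed
  have B_complete: "\<exists>s'. (s, s') \<in> prog_rel B \<and> s' w = y"
    if "rec_eval g (s i # s w # map s ys) y" for s y
  proof -
    from implementsD(5)[OF G, of s y] that obtain u where u: "(s, u) \<in> prog_rel G" "u v = y"
      by auto
    then have "(s, u(w := u v, i := Suc (u i))) \<in> prog_rel B"
      by (auto simp: B_def defs)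
    moreover have "(u(w := u v, i := Suc (u i))) w = y" using u(2) by (simp add: defs)
    ultimately show ?thesis by blast
  qed
  have map_eq: "map s' ys = map s ys" if "\<forall>j<n. s' j = s j" for s s' :: store
    using that ys by auto
  have loop_sound: "rec_eval (PrimRec f g) (s' i # map s ys) (s' w) \<and> (\<forall>j<n. s' j = s j)"
    if "(s, s') \<in> (prog_rel B)\<^sup>*" "rec_eval f (map s ys) (s w)" "s i = 0" for s s'
    using that(1)
  proof (induction rule: rtrancl_induct)
    case base
    then show ?case using that by (auto intro: rec_eval.PrimRec_0)
  next
    case (step u u')
    then show ?case using B_sound[OF step.hyps(2)] map_eq[of u s]
      by (auto intro: rec_eval.PrimRec_Suc)
  qed
  have loop_complete: "\<exists>s'. (s, s') \<in> (prog_rel B)\<^sup>* \<and> s' i = m \<and> s' w = y"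
    if "rec_eval (PrimRec f g) (m # map s ys) y" "rec_eval f (map s ys) (s w)" "s i = 0" for s m y
    using that(1)
  proof (induction m arbitrary: y)
    case 0
    then have "rec_eval f (map s ys) y" by (rule rec_evalE(5))
    \<comment> \<open>No round is made; determinism identifies \<open>y\<close> with the value
      already in \<open>w\<close>.\<close>
    then show ?case using that(2,3) rec_eval_deterministic by blast
  next
    case (Suc m)
    from Suc.prems obtain z where z: "rec_eval (PrimRec f g) (m # map s ys) z"
      "rec_eval g (m # z # map s ys) y" by (rule rec_evalE(6))
    from Suc.IH[OF z(1)] obtain u where u: "(s, u) \<in> (prog_rel B)\<^sup>*" "u i = m" "u w = z" by blast
    have "map u ys = map s ys" using loop_sound[OF u(1) that(2,3)] map_eq by blast
    with B_complete[of u y] z(2) u(2,3) obtain s' where "(u, s') \<in> prog_rel B" "s' w = y" by auto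
    then show ?case using u B_sound rtrancl_into_rtrancl by metis
  qed
  have "implements P n (max k l) xs r (PrimRec f g)"
    unfolding implements_def
  proof (intro conjI allI impI)
    show "n \<le> max k l" "prog_regs P \<subseteq> {..<max k l}"
      using implementsD(1,2)[OF F] implementsD(1,2)[OF G] a r by (auto simp: P_def B_def defs)
  next
    fix s s' assume "(s, s') \<in> prog_rel P"
    then obtain u1 u2 where u: "(s, u1) \<in> prog_rel F" "(u1(i := 0), u2) \<in> (prog_rel B)\<^sup>*"
      "u2 i = u2 a" "s' = u2(r := u2 w)"
      by (auto simp: P_def)
    have agr: "\<forall>j<n. (u1(i := 0)) j = s j"
      using implementsD(4)[OF F u(1)] by (auto simp: defs)
    then have m: "map (u1(i := 0)) ys = map s ys" by (rule map_eq)
    have "rec_eval f (map s ys) ((u1(i := 0)) w)"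
      using implementsD(3)[OF F u(1)] by (simp add: defs)
    with loop_sound[OF u(2)] m agr
    have L: "rec_eval (PrimRec f g) (u2 i # map s ys) (u2 w)" "\<forall>j<n. u2 j = s j" by auto
    have "u2 i = s a" using u(3) L(2) a by simp
    then show "rec_eval (PrimRec f g) (map s xs) (s' r)" using L(1) Cons u(4) by simp
    fix j assume "j < n" "j \<noteq> r"
    then show "s' j = s j" using L(2) u(4) by simp
  next
    fix s y assume y: "rec_eval (PrimRec f g) (map s xs) y"
    \<comment> \<open>A value of the recursion at any \<open>m\<close> rests on a value at
      \<open>0\<close>, so the initial run of \<open>F\<close> is not blocked.\<close>
    have "\<exists>z. rec_eval f (map s ys) z"
    proof -
      have "\<exists>z. rec_eval f (map s ys) z" if "rec_eval (PrimRec f g) (m # map s ys) y" for m y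
        using that
      proof (induction m arbitrary: y)
        case 0
        then show ?case by (rule rec_evalE(5)) blast
      next
        case (Suc m)
        from Suc.prems show ?case by (rule rec_evalE(6)) (rule Suc.IH)
      qed
      then show ?thesis using y Cons by auto
    qed
    then obtain u where u: "(s, u) \<in> prog_rel F" using implementsD(5)[OF F] by blast
    have agr: "\<forall>j<n. (u(i := 0)) j = s j"
      using implementsD(4)[OF F u] by (auto simp: defs)
    then have m: "map (u(i := 0)) ys = map s ys" by (rule map_eq)
    have fw: "rec_eval f (map (u(i := 0)) ys) ((u(i := 0)) w)"
      unfolding m using implementsD(3)[OF F u] by (simp add: defs)
    have "rec_eval (PrimRec f g) (s a # map (u(i := 0)) ys) y"
      unfolding m using y Cons by simp
    from loop_complete[OF this fw] obtain s' where
      s': "(u(i := 0), s') \<in> (prog_rel B)\<^sup>*" "s' i = s a" "s' w = y" by auto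
    have "s' a = s a" using loop_sound[OF s'(1) fw] agr a by auto
    then have "s' i = s' a" using s'(2) by simp
    then have "(s, s'(r := s' w)) \<in> prog_rel P"
      using u s'(1) by (simp add: P_def) blast
    then show "\<exists>s'. (s, s') \<in> prog_rel P \<and> s' r = y" using s'(3) by (metis fun_upd_same)
  qed
  then show ?thesis by blast
qed

text \<open>The search may pass \<open>y\<close> only if \<open>f\<close> has a positive value
  there, and after the loop \<open>f\<close> must have value \<open>0\<close>. Leaving the loop too
  early fails the final test, staying too long is blocked by \<open>G\<close>, so only the run that
  stops at the least zero survives.\<close>

lemma implementable_Mu:
  assumes f: "\<And>xs r n. set xs \<subseteq> {..<n} \<Longrightarrow> r < n \<Longrightarrow> \<exists>P k. implements P n k xs r f"
    and xs: "set xs \<subseteq> {..<n}" and r: "r < n"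
  shows "\<exists>P k. implements P n k xs r (Mu f)"
proof -
  define y t u N where "y = n" and "t = n + 1" and "u = n + 2" and "N = n + 3"
  note defs = y_def t_def u_def N_def
  have xsN: "set xs \<subseteq> {..<N}" using xs by (auto simp: defs)
  obtain F k where F: "implements F N k (y # xs) t f"
    using f[of "y # xs" N t] xsN by (auto simp: defs)
  \<comment> \<open>Positivity of register \<open>t\<close> is tested by guessing its value upwards from \<open>1\<close> in \<open>u\<close>.\<close>
  define G where "G = Seq (Act (Assign u [] 1)) (Seq (Star (Act (Assign u [u] 1))) (Act (Test t [u] 0)))"
  define B where "B = Seq F (Seq G (Act (Assign y [y] 1)))"
  define P where "P = Seq (Act (Assign y [] 0)) (Seq (Star B)
    (Seq F (Seq (Act (Test t [] 0)) (Act (Assign r [y] 0)))))"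
  have G_iff: "(s, s') \<in> prog_rel G \<longleftrightarrow> s t > 0 \<and> s' = s(u := s t)" for s s'
  proof -
    have "(s, s') \<in> prog_rel G \<longleftrightarrow> (\<exists>m. s' = s(u := 1 + m) \<and> s' t = s' u)"
      unfolding G_def prog_rel_Seq_iff prog_rel_count_up_iff by auto
    also have "\<dots> \<longleftrightarrow> s t > 0 \<and> s' = s(u := s t)"
      by (auto simp: defs gr0_conv_Suc)
    finally show ?thesis .
  qed
  have map_eq: "map s' xs = map s xs" if "\<forall>j<n. s' j = s j" for s s' :: store
    using that xs by auto
  have B_sound: "(\<exists>v>0. rec_eval f (s y # map s xs) v) \<and> s' y = Suc (s y) \<and> (\<forall>j<n. s' j = s j)"
    if "(s, s') \<in> prog_rel B" for s s'
  proof -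
    from that obtain z where z: "(s, z) \<in> prog_rel F" "z t > 0" "s' = z(u := z t, y := Suc (z y))"
      by (auto simp: B_def G_iff defs)
    show ?thesis
      using implementsD(3)[OF F z(1)] implementsD(4)[OF F z(1)] z(2,3) by (auto simp: defs)
  qed
  have B_complete: "\<exists>s'. (s, s') \<in> prog_rel B" if "rec_eval f (s y # map s xs) v" "v > 0" for s v
  proof -
    from implementsD(5)[OF F, of s v] that obtain z where z: "(s, z) \<in> prog_rel F" "z t = v"
      by auto
    then have "(s, z(u := z t, y := Suc (z y))) \<in> prog_rel B"
      using that(2) by (auto simp: B_def G_iff defs)
    then show ?thesis by blast
  qed
  have loop_sound: "(\<forall>i<s' y. \<exists>v>0. rec_eval f (i # map s xs) v) \<and> (\<forall>j<n. s' j = s j)"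
    if "(s, s') \<in> (prog_rel B)\<^sup>*" "s y = 0" for s s'
    using that(1)
  proof (induction rule: rtrancl_induct)
    case base
    then show ?case using that by simp
  next
    case (step z z')
    then show ?case using B_sound[OF step.hyps(2)] map_eq[of z s] by (auto simp: less_Suc_eq)
  qed
  have loop_complete: "\<exists>s'. (s, s') \<in> (prog_rel B)\<^sup>* \<and> s' y = m"
    if "\<forall>i<m. \<exists>v>0. rec_eval f (i # map s xs) v" "s y = 0" for s m
    using that(1)
  proof (induction m)
    case 0
    then show ?case using that(2) by blast
  next
    case (Suc m)
    then obtain z where z: "(s, z) \<in> (prog_rel B)\<^sup>*" "z y = m" by auto
    have "map z xs = map s xs" using loop_sound[OF z(1) that(2)] map_eq by blast
    with B_complete[of z] Suc.prems z(2) obtain s' where "(z, s') \<in> prog_rel B" by force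
    then show ?case using z B_sound rtrancl_into_rtrancl by metis
  qed
  have "implements P n k xs r (Mu f)"
    unfolding implements_def
  proof (intro conjI allI impI)
    show "n \<le> k" "prog_regs P \<subseteq> {..<k}"
      using implementsD(1,2)[OF F] r by (auto simp: P_def B_def G_def defs)
  next
    fix s s' assume "(s, s') \<in> prog_rel P"
    then obtain u1 u2 where u: "(s(y := 0), u1) \<in> (prog_rel B)\<^sup>*" "(u1, u2) \<in> prog_rel F"
      "u2 t = 0" "s' = u2(r := u2 y)"
      by (auto simp: P_def)
    have m: "map (s(y := 0)) xs = map s xs" by (rule map_eq) (simp add: defs)
    have L: "\<forall>i<u1 y. \<exists>v>0. rec_eval f (i # map s xs) v" "\<forall>j<n. u1 j = s j"
      using loop_sound[OF u(1), unfolded m] by (auto simp: defs)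
    have "rec_eval f (u1 y # map s xs) 0"
      using implementsD(3)[OF F u(2)] u(3) map_eq[OF L(2)] by simp
    moreover have "u2 y = u1 y" using implementsD(4)[OF F u(2), of y] by (simp add: defs)
    ultimately show "rec_eval (Mu f) (map s xs) (s' r)"
      using L(1) u(4) by (auto intro: rec_eval.Mu)
    fix j assume "j < n" "j \<noteq> r"
    then show "s' j = s j"
      using L(2) u(4) implementsD(4)[OF F u(2), of j] by (simp add: defs)
  next
    fix s m assume "rec_eval (Mu f) (map s xs) m"
    then obtain 0: "rec_eval f (m # map s xs) 0" and less: "\<forall>i<m. \<exists>v>0. rec_eval f (i # map s xs) v"
      by (rule rec_evalE(7))
    have m: "map (s(y := 0)) xs = map s xs" by (rule map_eq) (simp add: defs)
    from loop_complete[of m "s(y := 0)", unfolded m] less obtain u1 where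
      u1: "(s(y := 0), u1) \<in> (prog_rel B)\<^sup>*" "u1 y = m" by auto
    have "map u1 xs = map s xs"
      using loop_sound[OF u1(1)] m by (intro map_eq) (auto simp: defs)
    with implementsD(5)[OF F, of u1 0] 0 u1(2) obtain u2 where
      u2: "(u1, u2) \<in> prog_rel F" "u2 t = 0" by auto
    have "u2 y = m" using implementsD(4)[OF F u2(1), of y] u1(2) by (simp add: defs)
    moreover have "(s, u2(r := u2 y)) \<in> prog_rel P"
      using u1(1) u2 by (simp add: P_def) blast
    ultimately show "\<exists>s'. (s, s') \<in> prog_rel P \<and> s' r = m" by (metis fun_upd_same)
  qed
  then show ?thesis by blast
qed

text \<open>The bound \<open>n\<close> on the protected registers is arbitrary in the induction,
  which lets each construct raise it to protect its own temporaries.\<close>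

lemma implementable:
  assumes "set xs \<subseteq> {..<n}" "r < n"
  shows "\<exists>P k. implements P n k xs r g"
  using assms
proof (induction g arbitrary: xs r n)
  case Zero
  have "implements (Act (Assign r [] 0)) n n xs r Zero"
    using Zero by (auto simp: implements_def intro: rec_eval.Zero elim: rec_evalE(1))
  then show ?case by blast
next
  case Succ
  show ?case
  proof (cases "\<exists>x. xs = [x]")
    case True
    then obtain x where "xs = [x]" by blast
    then have "implements (Act (Assign r [x] 1)) n n xs r Succ"
      using Succ by (auto simp: implements_def intro: rec_eval.Succ elim: rec_evalE(2))
    then show ?thesis by blast
  next
    case False
    then have "\<not> rec_eval Succ (map s xs) y" for s y
      by (auto elim!: rec_evalE(2))
    then show ?thesis using implements_fail Succ by blast
  qed
next
  case (Proj i)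
  show ?case
  proof (cases "i < length xs")
    case True
    then have "implements (Act (Assign r [xs ! i] 0)) n n xs r (Proj i)"
      using Proj rec_eval.Proj[of i "map _ xs"] subsetD[OF Proj.prems(1) nth_mem[OF True]]
      by (auto simp: implements_def elim!: rec_evalE(3))
    then show ?thesis by blast
  next
    case False
    then have "\<not> rec_eval (Proj i) (map s xs) y" for s y
      by (auto elim!: rec_evalE(3))
    then show ?thesis using implements_fail Proj by blast
  qed
next
  case (Comp f gs)
  show ?case by (rule implementable_Comp) (use Comp in auto)
next
  case (PrimRec f g)
  show ?case by (rule implementable_PrimRec) (use PrimRec in auto)
next
  case (Mu f)
  show ?case by (rule implementable_Mu) (use Mu in auto)
qed

section \<open>Control flow graphs\<close>

primrec prog_size :: "prog \<Rightarrow> nat" where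
  "prog_size (Act a) = 0"
| "prog_size (Seq P Q) = Suc (prog_size P + prog_size Q)"
| "prog_size (Star P) = Suc (prog_size P)"

abbreviation skip :: act where "skip \<equiv> Test 0 [0] 0"

text \<open>
  \<open>edges P p q n\<close> leads from label \<open>p\<close> to label \<open>q\<close> and draws its inner labels from
  \<open>{n..<n + prog_size P}\<close>. A loop gets a header label of its own, so that \<open>p\<close> and \<open>q\<close> may coincide.
\<close>

primrec edges :: "prog \<Rightarrow> nat \<Rightarrow> nat \<Rightarrow> nat \<Rightarrow> (nat \<times> act \<times> nat) list" where
  "edges (Act a) p q n = [(p, a, q)]"
| "edges (Seq P Q) p q n = edges P p n (Suc n) @ edges Q n q (Suc n + prog_size P)"
| "edges (Star P) p q n = (p, skip, n) # (n, skip, q) # edges P n n (Suc n)"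

definition edge_rel :: "(nat \<times> act \<times> nat) list \<Rightarrow> ((nat \<times> store) \<times> nat \<times> store) set" where
  "edge_rel E = {((p, s), (q, s')). \<exists>a. (p, a, q) \<in> set E \<and> (s, s') \<in> act_rel a}"

text \<open>Floyd's inductive assertions: once the set at the start label contains the initial
  store, every reachable store lies in the set of its label.\<close>

definition inductive_labelling :: "(nat \<times> act \<times> nat) list \<Rightarrow> (nat \<Rightarrow> store set) \<Rightarrow> bool" where
  "inductive_labelling E W \<longleftrightarrow> (\<forall>(p, a, q) \<in> set E. act_rel a `` W p \<subseteq> W q)"

lemma inductive_labelling_append [simp]:
  "inductive_labelling (E @ F) W \<longleftrightarrow> inductive_labelling E W \<and> inductive_labelling F W"
  by (auto simp only: inductive_labelling_def set_append ball_Un)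

lemma inductive_labelling_Cons [simp]:
  "inductive_labelling ((p, a, q) # E) W \<longleftrightarrow> act_rel a `` W p \<subseteq> W q \<and> inductive_labelling E W"
  by (simp add: inductive_labelling_def)

text \<open>Register \<open>0\<close> enters through the \<open>skip\<close> edges of loops.\<close>

lemma edges_regs:
  "(x, a, y) \<in> set (edges P p q n) \<Longrightarrow> act_regs a \<subseteq> insert 0 (prog_regs P)"
proof (induction P arbitrary: p q n)
  case (Seq P Q)
  from Seq.prems consider "(x, a, y) \<in> set (edges P p n (Suc n))"
    | "(x, a, y) \<in> set (edges Q n q (Suc n + prog_size P))" by auto
  then show ?case using Seq.IH by cases fastforce+
qed auto

text \<open>Keeps the labels of one subprogram apart from the inner labels of the next one in
  \<open>edges_labelling\<close>.\<close>

lemma edges_labels: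
  "(x, a, y) \<in> set (edges P p q n) \<Longrightarrow> p < n \<Longrightarrow> q < n \<Longrightarrow>
     x < n + prog_size P \<and> y < n + prog_size P"
proof (induction P arbitrary: p q n)
  case (Seq P Q)
  then show ?case
    using Seq.IH(1)[of p n "Suc n"] Seq.IH(2)[of n q "Suc n + prog_size P"] by fastforce
next
  case (Star P)
  then show ?case using Star.IH[of n n "Suc n"] by fastforce
qed auto

lemma edges_complete:
  assumes "(s, s') \<in> prog_rel P" "set (edges P p q n) \<subseteq> set E"
  shows "((p, s), (q, s')) \<in> (edge_rel E)\<^sup>*"
  using assms
proof (induction P arbitrary: p q n s s')
  case (Act a)
  then show ?case by (auto simp: edge_rel_def)
next
  case (Seq P Q)
  from Seq.prems(1) obtain u where u: "(s, u) \<in> prog_rel P" "(u, s') \<in> prog_rel Q" by auto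
  have "((p, s), (n, u)) \<in> (edge_rel E)\<^sup>*" using Seq.IH(1)[OF u(1)] Seq.prems(2) by auto
  moreover have "((n, u), (q, s')) \<in> (edge_rel E)\<^sup>*" using Seq.IH(2)[OF u(2)] Seq.prems(2) by auto
  ultimately show ?case by (rule rtrancl_trans)
next
  case (Star P)
  have skip: "((p, s), (n, s)) \<in> edge_rel E" "((n, s'), (q, s')) \<in> edge_rel E"
    using Star.prems(2) by (auto simp: edge_rel_def)
  have "(s, s') \<in> (prog_rel P)\<^sup>*" using Star.prems(1) by simp
  then have "((n, s), (n, s')) \<in> (edge_rel E)\<^sup>*"
  proof (induction rule: rtrancl_induct)
    case (step y z)
    have "((n, y), (n, z)) \<in> (edge_rel E)\<^sup>*"
      using Star.IH[OF step.hyps(2), of n n "Suc n"] Star.prems(2) by auto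
    with step.IH show ?case by (rule rtrancl_trans)
  qed simp
  with skip show ?case by (meson converse_rtrancl_into_rtrancl rtrancl.rtrancl_into_rtrancl)
qed

text \<open>Soundness of the graph without decomposing runs: assertions at \<open>p\<close> and
  \<open>q\<close> that are correct for the relation of the program extend to the inner labels, by
  strongest postconditions, while all other labels keep their sets.\<close>

lemma edges_labelling:
  assumes "prog_rel P `` W p \<subseteq> W q" "p < n" "q < n"
  shows "\<exists>W'. (\<forall>l. l < n \<or> n + prog_size P \<le> l \<longrightarrow> W' l = W l) \<and>
           inductive_labelling (edges P p q n) W'"
  using assms
proof (induction P arbitrary: p q n W)
  case (Act a)
  then show ?case by (auto simp: inductive_labelling_def)
next
  case (Seq P Q)
  \<comment> \<open>The midpoint receives the strongest postcondition of \<open>P\<close>.\<close>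
  let ?W1 = "W(n := prog_rel P `` W p)" and ?m = "Suc n + prog_size P"
  obtain W2 where W2: "\<forall>l. l < Suc n \<or> ?m \<le> l \<longrightarrow> W2 l = ?W1 l"
    "inductive_labelling (edges P p n (Suc n)) W2"
    using Seq.IH(1)[of ?W1 p n "Suc n"] Seq.prems by auto
  have "W2 n = prog_rel P `` W p" "W2 q = W q" using W2(1) Seq.prems by auto
  then have "prog_rel Q `` W2 n \<subseteq> W2 q"
    using Seq.prems(1) by (auto simp: prog_rel.simps(2) relcomp_Image)
  then obtain W3 where W3: "\<forall>l. l < ?m \<or> ?m + prog_size Q \<le> l \<longrightarrow> W3 l = W2 l"
    "inductive_labelling (edges Q n q ?m) W3"
    using Seq.IH(2)[of W2 n q ?m] Seq.prems by auto
  \<comment> \<open>Labelling the inside of \<open>Q\<close> changes sets only at labels from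
    \<open>?m\<close> on, and the edges of \<open>P\<close> stay below \<open>?m\<close>.\<close>
  have "inductive_labelling (edges P p n (Suc n)) W3"
    unfolding inductive_labelling_def
  proof clarify
    fix x a y s s' assume e: "(x, a, y) \<in> set (edges P p n (Suc n))" and s: "s \<in> W3 x" "(s, s') \<in> act_rel a"
    have "x < ?m" "y < ?m" using edges_labels[OF e] Seq.prems by auto
    then have "W3 x = W2 x" "W3 y = W2 y" using W3(1) by auto
    then show "s' \<in> W3 y" using W2(2) e s by (fastforce simp: inductive_labelling_def)
  qed
  then have "inductive_labelling (edges (Seq P Q) p q n) W3"
    using W3(2) by simp
  moreover have "W3 l = W l" if "l < n \<or> n + prog_size (Seq P Q) \<le> l" for l
  proof -
    have "W3 l = W2 l" "W2 l = ?W1 l" "l \<noteq> n" using that W3(1) W2(1) by auto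
    then show ?thesis by simp
  qed
  ultimately show ?case by blast
next
  case (Star P)
  \<comment> \<open>The loop header receives everything reachable by iterating \<open>P\<close>,
    which is a loop invariant by construction.\<close>
  let ?W1 = "W(n := (prog_rel P)\<^sup>* `` W p)"
  have "prog_rel P `` ?W1 n \<subseteq> ?W1 n" by (auto intro: rtrancl_into_rtrancl)
  then obtain W2 where W2: "\<forall>l. l < Suc n \<or> Suc n + prog_size P \<le> l \<longrightarrow> W2 l = ?W1 l"
    "inductive_labelling (edges P n n (Suc n)) W2"
    using Star.IH[of ?W1 n n "Suc n"] by auto
  have "W2 p = W p" "W2 q = W q" "W2 n = (prog_rel P)\<^sup>* `` W p" using W2(1) Star.prems by auto
  then have "inductive_labelling (edges (Star P) p q n) W2"
    using W2(2) Star.prems(1) by auto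
  moreover have "W2 l = W l" if "l < n \<or> n + prog_size (Star P) \<le> l" for l
    using that W2(1) by auto
  ultimately show ?case by blast
qed

section \<open>Linear constraints for control flow graphs\<close>

lemma dot_map_upt:
  assumes "length v = N"
  shows "dot (map a [0..<N]) v = (\<Sum>i<N. of_rat (a i) * v ! i)"
proof -
  have "map2 (\<lambda>a x. of_rat a * x) (map a [0..<N]) v = map (\<lambda>i. of_rat (a i) * v ! i) [0..<N]"
    using assms by (intro nth_equalityI) auto
  then show ?thesis
    by (simp add: dot_def interv_sum_list_conv_sum_set_nat atLeast0LessThan)
qed

text \<open>An equation between coordinate \<open>j\<close> and the sum over \<open>qs\<close> plus
  \<open>c\<close>, written as two opposite inequalities. Multiplicities are counted because
  \<open>qs\<close> may repeat an index, and \<open>j\<close> itself may occur in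
  \<open>qs\<close>.\<close>

definition affine_eq :: "nat \<Rightarrow> nat \<Rightarrow> nat list \<Rightarrow> nat \<Rightarrow> lin_constr" where
  "affine_eq N j qs c =
     (let a = (\<lambda>i. of_bool (i = j) - of_nat (count_list qs i)) in
      Conj (LE (map a [0..<N]) (of_nat c)) (LE (map (\<lambda>i. - a i) [0..<N]) (- of_nat c)))"

lemma sum_count_list:
  fixes qs :: "nat list"
  assumes "set qs \<subseteq> {..<N}"
  shows "(\<Sum>i<N. real (count_list qs i) * f i) = (\<Sum>q\<leftarrow>qs. f q)"
  using assms
proof (induction qs)
  case (Cons q qs)
  have "(\<Sum>i<N. real (count_list (q # qs) i) * f i)
      = (\<Sum>i<N. real (count_list qs i) * f i + (if i = q then f i else 0))"
    by (intro sum.cong) (auto simp: algebra_simps)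
  moreover have "(\<Sum>i<N. if i = q then f i else 0) = f q"
    using Cons.prems by (subst sum.delta) auto
  ultimately show ?case using Cons by (simp add: sum.distrib)
qed simp

lemma holds_affine_eq:
  assumes "length v = N" "j < N" "set qs \<subseteq> {..<N}"
  shows "holds (affine_eq N j qs c) v \<longleftrightarrow> v ! j = (\<Sum>q\<leftarrow>qs. v ! q) + real c"
proof -
  define a :: "nat \<Rightarrow> rat" where "a = (\<lambda>i. of_bool (i = j) - of_nat (count_list qs i))"
  have "(\<Sum>i<N. of_rat (a i) * v ! i)
      = (\<Sum>i<N. (if i = j then v ! i else 0) - real (count_list qs i) * v ! i)"
    by (intro sum.cong) (auto simp: a_def of_rat_diff algebra_simps)
  also have "\<dots> = v ! j - (\<Sum>q\<leftarrow>qs. v ! q)"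
    using assms by (simp add: sum_subtractf sum_count_list)
  finally have s: "(\<Sum>i<N. of_rat (a i) * v ! i) = v ! j - (\<Sum>q\<leftarrow>qs. v ! q)" .
  have "(\<Sum>i<N. of_rat (- a i) * v ! i) = - (v ! j - (\<Sum>q\<leftarrow>qs. v ! q))"
    by (simp add: of_rat_minus sum_negf s)
  with s show ?thesis
    unfolding affine_eq_def Let_def a_def[symmetric] using assms(1)
    by (auto simp: dot_map_upt of_rat_minus)
qed

lemma constr_over_affine_eq [simp]: "constr_over N (affine_eq N j qs c)"
  by (simp add: affine_eq_def Let_def)

definition trivial_constr :: "nat \<Rightarrow> lin_constr" where
  "trivial_constr N = LE (replicate N 0) 0"

lemma constr_over_trivial [simp]: "constr_over N (trivial_constr N)"
  by (simp add: trivial_constr_def)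

lemma dot_replicate_0: "dot (replicate N 0) v = 0"
proof (induction N arbitrary: v)
  case (Suc N)
  then show ?case by (cases v) (auto simp: dot_def)
qed (simp add: dot_def)

lemma holds_trivial [simp]: "holds (trivial_constr N) v"
  by (simp add: trivial_constr_def dot_replicate_0)

definition conj_list :: "nat \<Rightarrow> lin_constr list \<Rightarrow> lin_constr" where
  "conj_list N Fs = foldr Conj Fs (trivial_constr N)"

lemma holds_conj_list: "holds (conj_list N Fs) v \<longleftrightarrow> (\<forall>F \<in> set Fs. holds F v)"
  by (induction Fs) (auto simp: conj_list_def)

lemma constr_over_conj_list: "constr_over N (conj_list N Fs) \<longleftrightarrow> (\<forall>F \<in> set Fs. constr_over N F)"
  by (induction Fs) (auto simp: conj_list_def)

lemma holds_foldr_Disj: "holds (foldr Disj Fs G) v \<longleftrightarrow> holds G v \<or> (\<exists>F \<in> set Fs. holds F v)"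
  by (induction Fs) auto

lemma constr_over_foldr_Disj:
  "constr_over N (foldr Disj Fs G) \<longleftrightarrow> constr_over N G \<and> (\<forall>F \<in> set Fs. constr_over N F)"
  by (induction Fs) auto

section \<open>Configurations as real vectors and the constraints of a transition\<close>

definition config :: "nat \<Rightarrow> nat \<Rightarrow> store \<Rightarrow> real list" where
  "config k l s = real l # map (\<lambda>j. real (s j)) [0..<k]"

lemma length_config [simp]: "length (config k l s) = Suc k"
  by (simp add: config_def)

lemma config_nth [simp]: "config k l s ! 0 = real l" "j < k \<Longrightarrow> config k l s ! Suc j = real (s j)"
  by (simp_all add: config_def)

lemma eq_config_iff:
  assumes "length x = Suc k"
  shows "x = config k l s \<longleftrightarrow> x ! 0 = real l \<and> (\<forall>j<k. x ! Suc j = real (s j))"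
proof -
  obtain y ys where "x = y # ys" "length ys = k" using assms by (cases x) auto
  moreover from this have "ys = map (\<lambda>j. real (s j)) [0..<k] \<longleftrightarrow> (\<forall>j<k. ys ! j = real (s j))"
    by (simp add: list_eq_iff_nth_eq[of ys])
  ultimately show ?thesis by (simp add: config_def)
qed

text \<open>In the concatenation of two configurations the old register \<open>j\<close> sits at
  \<open>Suc j\<close> and the new one at \<open>Suc k + Suc j\<close>. Registers that an action
  leaves alone need explicit frame equations.\<close>

primrec act_constrs :: "nat \<Rightarrow> act \<Rightarrow> lin_constr list" where
  "act_constrs k (Assign r qs c) =
     map (\<lambda>j. if j = r then affine_eq (Suc k + Suc k) (Suc k + Suc j) (map Suc qs) c
              else affine_eq (Suc k + Suc k) (Suc k + Suc j) [Suc j] 0) [0..<k]"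
| "act_constrs k (Test r qs c) =
     affine_eq (Suc k + Suc k) (Suc r) (map Suc qs) c #
     map (\<lambda>j. affine_eq (Suc k + Suc k) (Suc k + Suc j) [Suc j] 0) [0..<k]"

fun edge_constr :: "nat \<Rightarrow> nat \<times> act \<times> nat \<Rightarrow> lin_constr" where
  "edge_constr k (p, a, q) = conj_list (Suc k + Suc k)
     (affine_eq (Suc k + Suc k) 0 [] p # affine_eq (Suc k + Suc k) (Suc k) [] q # act_constrs k a)"

definition stutter_constr :: "nat \<Rightarrow> lin_constr" where
  "stutter_constr k = conj_list (Suc k + Suc k)
     (map (\<lambda>j. affine_eq (Suc k + Suc k) (Suc k + j) [j] 0) [0..<Suc k])"

definition trans_constr :: "nat \<Rightarrow> (nat \<times> act \<times> nat) list \<Rightarrow> lin_constr" where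
  "trans_constr k E = foldr Disj (map (edge_constr k) E) (stutter_constr k)"

definition init_constr :: "nat \<Rightarrow> lin_constr" where
  "init_constr k = conj_list (Suc k)
     (affine_eq (Suc k) 0 [] 1 # map (\<lambda>j. affine_eq (Suc k) (Suc j) [] 0) [0..<k])"

lemma constr_over_act_constrs: "F \<in> set (act_constrs k a) \<Longrightarrow> constr_over (Suc k + Suc k) F"
  by (cases a) (auto simp del: upt_Suc add_Suc_right)

lemma constr_over_trans: "constr_over (Suc k + Suc k) (trans_constr k E)"
  unfolding trans_constr_def stutter_constr_def
  using constr_over_act_constrs
  by (auto simp: constr_over_foldr_Disj constr_over_conj_list simp del: upt_Suc add_Suc_right add_Suc)

lemma constr_over_init: "constr_over (Suc k) (init_constr k)"
  by (auto simp: init_constr_def constr_over_conj_list)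

lemma holds_init:
  assumes "length x = Suc k"
  shows "holds (init_constr k) x \<longleftrightarrow> x = config k 1 (\<lambda>_. 0)"
  using assms by (auto simp: init_constr_def holds_conj_list holds_affine_eq eq_config_iff)

lemma append_config_nth:
  assumes "length x' = Suc k"
  shows "(config k l s @ x') ! 0 = real l" "j < k \<Longrightarrow> (config k l s @ x') ! Suc j = real (s j)"
    "(config k l s @ x') ! (Suc k + j) = x' ! j"
  using assms by (simp_all add: nth_append del: add_Suc_right add_Suc)

lemma sum_append_config:
  assumes "length x' = Suc k" "set qs \<subseteq> {..<k}"
  shows "(\<Sum>q\<leftarrow>map Suc qs. (config k l s @ x') ! q) = real (sum_list (map s qs))"
  using assms(2) by (induction qs) (auto simp: append_config_nth[OF assms(1)])

lemma holds_affine_config: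
  assumes "length x' = Suc k" "set qs \<subseteq> {..<k}"
  shows "r < k \<Longrightarrow> holds (affine_eq (Suc k + Suc k) (Suc r) (map Suc qs) c) (config k l s @ x') \<longleftrightarrow>
           s r = sum_list (map s qs) + c"
    and "j \<le> k \<Longrightarrow> holds (affine_eq (Suc k + Suc k) (Suc k + j) (map Suc qs) c) (config k l s @ x') \<longleftrightarrow>
           x' ! j = real (sum_list (map s qs) + c)"
proof -
  have len: "length (config k l s @ x') = Suc k + Suc k" using assms by simp
  have qs: "set (map Suc qs) \<subseteq> {..<Suc k + Suc k}" using assms(2) by auto
  show "holds (affine_eq (Suc k + Suc k) (Suc r) (map Suc qs) c) (config k l s @ x') \<longleftrightarrow>
           s r = sum_list (map s qs) + c" if "r < k"
    using that
    by (subst holds_affine_eq[OF len _ qs], simp,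
        unfold sum_append_config[OF assms] append_config_nth(2)[OF assms(1) that])
      (simp only: of_nat_add[symmetric] of_nat_eq_iff)
  show "holds (affine_eq (Suc k + Suc k) (Suc k + j) (map Suc qs) c) (config k l s @ x') \<longleftrightarrow>
           x' ! j = real (sum_list (map s qs) + c)" if "j \<le> k"
    using that
    by (subst holds_affine_eq[OF len _ qs], simp,
        unfold sum_append_config[OF assms] append_config_nth(3)[OF assms(1)])
      (simp only: of_nat_add)
qed

lemma holds_act_constrs:
  assumes "length x' = Suc k" "act_regs a \<subseteq> {..<k}" "x' ! 0 = real q"
  shows "(\<forall>F \<in> set (act_constrs k a). holds F (config k l s @ x')) \<longleftrightarrow>
           (\<exists>s'. (s, s') \<in> act_rel a \<and> x' = config k q s')"
proof -
  have frame: "holds (affine_eq (Suc k + Suc k) (Suc k + Suc j) [Suc j] 0) (config k l s @ x') \<longleftrightarrow>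
      x' ! Suc j = real (s j)" if "j < k" for j
    using holds_affine_config(2)[OF assms(1), of "[j]" "Suc j" 0] that by simp
  show ?thesis
  proof (cases a)
    case (Assign r qs c)
    then have rq: "r < k" "set qs \<subseteq> {..<k}" using assms(2) by auto
    have "(\<forall>F \<in> set (act_constrs k a). holds F (config k l s @ x')) \<longleftrightarrow>
        (\<forall>j<k. x' ! Suc j = real ((s(r := sum_list (map s qs) + c)) j))"
      using frame holds_affine_config(2)[OF assms(1) rq(2), of "Suc r" c] rq(1)
      by (auto simp: Assign simp del: add_Suc_right add_Suc)
    then show ?thesis using assms by (simp add: Assign eq_config_iff)
  next
    case (Test r qs c)
    then have rq: "r < k" "set qs \<subseteq> {..<k}" using assms(2) by auto
    have "(\<forall>F \<in> set (act_constrs k a). holds F (config k l s @ x')) \<longleftrightarrow>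
        s r = sum_list (map s qs) + c \<and> (\<forall>j<k. x' ! Suc j = real (s j))"
      using frame holds_affine_config(1)[OF assms(1) rq(2) rq(1)]
      by (auto simp: Test simp del: add_Suc_right add_Suc)
    then show ?thesis using assms by (auto simp add: Test eq_config_iff)
  qed
qed

lemma holds_edge_constr:
  assumes "length x' = Suc k" "act_regs a \<subseteq> {..<k}"
  shows "holds (edge_constr k (p, a, q)) (config k l s @ x') \<longleftrightarrow>
           l = p \<and> (\<exists>s'. (s, s') \<in> act_rel a \<and> x' = config k q s')"
proof -
  have "holds (affine_eq (Suc k + Suc k) 0 [] p) (config k l s @ x') \<longleftrightarrow> l = p"
    using assms(1) by (subst holds_affine_eq) (auto simp: append_config_nth)
  moreover have "holds (affine_eq (Suc k + Suc k) (Suc k) [] q) (config k l s @ x') \<longleftrightarrow> x' ! 0 = real q"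
    using holds_affine_config(2)[OF assms(1), of "[]" 0 q] by simp
  moreover have "x' ! 0 = real q" if "x' = config k q s'" for s' using that by simp
  ultimately show ?thesis
    using holds_act_constrs[OF assms, of q l s]
    by (auto simp: holds_conj_list simp del: add_Suc_right add_Suc)
qed

lemma holds_stutter_constr:
  assumes "length x' = Suc k"
  shows "holds (stutter_constr k) (config k l s @ x') \<longleftrightarrow> x' = config k l s"
proof -
  have "holds (affine_eq (Suc k + Suc k) (Suc k + j) [j] 0) (config k l s @ x') \<longleftrightarrow>
      x' ! j = config k l s ! j" if "j < Suc k" for j
    using assms that append_config_nth(3)[OF assms, of l s j]
    by (subst holds_affine_eq) (auto simp: nth_append simp del: add_Suc_right add_Suc)
  then show ?thesis
    unfolding stutter_constr_def holds_conj_list list_eq_iff_nth_eq[of x']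
    using assms by (auto simp del: upt_Suc add_Suc_right add_Suc)
qed

text \<open>Although states are arbitrary real vectors, a configuration has only configurations as
  successors, since every disjunct fixes all coordinates of \<open>x'\<close> by equations.\<close>

lemma holds_trans_constr:
  assumes "length x' = Suc k" "\<And>p a q. (p, a, q) \<in> set E \<Longrightarrow> act_regs a \<subseteq> {..<k}"
  shows "holds (trans_constr k E) (config k l s @ x') \<longleftrightarrow>
           x' = config k l s \<or> (\<exists>q s'. ((l, s), (q, s')) \<in> edge_rel E \<and> x' = config k q s')"
proof -
  have "(\<exists>F \<in> set (map (edge_constr k) E). holds F (config k l s @ x')) \<longleftrightarrow>
      (\<exists>p a q. (p, a, q) \<in> set E \<and> holds (edge_constr k (p, a, q)) (config k l s @ x'))"
    by force
  also have "\<dots> \<longleftrightarrow> (\<exists>p a q. (p, a, q) \<in> set E \<and> l = p \<and>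
      (\<exists>s'. (s, s') \<in> act_rel a \<and> x' = config k q s'))"
    by (intro ex_cong1 conj_cong refl holds_edge_constr[OF assms])
  also have "\<dots> \<longleftrightarrow> (\<exists>q s'. ((l, s), (q, s')) \<in> edge_rel E \<and> x' = config k q s')"
    by (auto simp: edge_rel_def)
  finally show ?thesis
    by (simp add: trans_constr_def holds_foldr_Disj holds_stutter_constr[OF assms(1)]
        del: edge_constr.simps)
qed

section \<open>Systems with one trivial agent\<close>

text \<open>Well-formedness asks for an agent. With all dimensions \<open>0\<close> the only joint
  action is \<open>[[]]\<close>, whose concatenation is empty, so the transition constraint speaks
  of \<open>x @ x'\<close> alone.\<close>

definition trivial_agent :: agent where
  "trivial_agent = \<lparr>act_dim = 0, obs_dim = 0, hid_dim = 0, acts = {[]}, obss = {[]}, hids = {[]},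
     init_hids = {[]}, observe = (\<lambda>_. []), policy = (\<lambda>_. ([], []))\<rparr>"

definition trivial_agent_desc :: "nat \<Rightarrow> agent_desc" where
  "trivial_agent_desc m = \<lparr>d_act_dim = 0, d_obs_dim = 0, d_hid_dim = 0,
     d_init_hids = trivial_constr 0, d_observe = trivial_constr m, d_policy = trivial_constr 0\<rparr>"

definition closed_mas :: "nat \<Rightarrow> lin_constr \<Rightarrow> lin_constr \<Rightarrow> mn_mas" where
  "closed_mas m I T = \<lparr>env_dim = m, states = vecs m, init_states = {x \<in> vecs m. holds I x},
     agents = [trivial_agent], trans_rel = (\<lambda>x as. {x' \<in> vecs m. holds T (x @ x')})\<rparr>"

definition closed_desc :: "nat \<Rightarrow> lin_constr \<Rightarrow> lin_constr \<Rightarrow> mas_desc" where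
  "closed_desc m I T = \<lparr>d_env_dim = m, d_init_states = I,
     d_agents = [trivial_agent_desc m], d_trans = T\<rparr>"

lemma joint_acts_closed_mas: "joint_acts (closed_mas m I T) = {[[]]}"
  by (auto simp: joint_acts_def closed_mas_def trivial_agent_def set_Cons_def)

lemma joint_hids_closed_mas:
  "joint_hids (closed_mas m I T) = {[[]]}" "joint_init_hids (closed_mas m I T) = {[[]]}"
  by (auto simp: joint_hids_def joint_init_hids_def closed_mas_def trivial_agent_def set_Cons_def)

lemma wf_closed_mas: "wf_mn_mas (closed_mas m I T)"
  by (auto simp: wf_mn_mas_def wf_agent_def closed_mas_def trivial_agent_def vecs_def)

lemma linearly_defines_closed_mas:
  assumes "constr_over m I" "constr_over (m + m) T"
  shows "linearly_defines (closed_desc m I T) (closed_mas m I T)"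
  using assms joint_acts_closed_mas[of m I T]
  by (simp add: linearly_defines_def agent_linearly_defines_def closed_mas_def closed_desc_def
      trivial_agent_def trivial_agent_desc_def vecs_def)

lemma closed_mas_satisfies_iff:
  "closed_mas m I T \<Turnstile> \<phi> \<longleftrightarrow>
     (\<forall>x. (\<forall>t. length (x t) = m \<and> holds T (x t @ x (Suc t))) \<and> holds I (x 0) \<longrightarrow> sat_at x 0 \<phi>)"
proof -
  have path: "is_path (closed_mas m I T) x h \<longleftrightarrow>
      (\<forall>t. length (x t) = m \<and> holds T (x t @ x (Suc t))) \<and> h = (\<lambda>_. [[]])" for x h
    unfolding is_path_def joint_hids_closed_mas
    by (auto simp: joint_policy_def joint_observe_def closed_mas_def trivial_agent_def vecs_def)
  show ?thesis
    unfolding satisfies_def path joint_hids_closed_mas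
    by (auto simp: closed_mas_def vecs_def)
qed

section \<open>Reachability as an LTL specification\<close>

text \<open>The entry is label \<open>1\<close>, the exit label \<open>0\<close>, and inner labels
  start at \<open>2\<close>. The exit has the least label so that the inequalities in
  \<open>avoids\<close> can single it out.\<close>

definition prog_mas :: "nat \<Rightarrow> prog \<Rightarrow> mn_mas" where
  "prog_mas k P = closed_mas (Suc k) (init_constr k) (trans_constr k (edges P 1 0 2))"

definition prog_desc :: "nat \<Rightarrow> prog \<Rightarrow> mas_desc" where
  "prog_desc k P = closed_desc (Suc k) (init_constr k) (trans_constr k (edges P 1 0 2))"

definition label_plus_reg :: "nat \<Rightarrow> rat list" where
  "label_plus_reg k = map (\<lambda>i. of_bool (i \<le> 1)) [0..<Suc k]"

definition reg :: "nat \<Rightarrow> rat list" where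
  "reg k = map (\<lambda>i. of_bool (i = 1)) [0..<Suc k]"

text \<open>
  In a configuration with label \<open>l\<close> and value \<open>e\<close> of register \<open>0\<close>, the specification is violated
  iff \<open>l + e \<le> n + 1\<close> and \<open>e > n\<close>, that is, iff \<open>l = 0\<close> (the exit label) and \<open>e = n + 1\<close>.
\<close>

definition avoids :: "nat \<Rightarrow> nat \<Rightarrow> ltl" where
  "avoids k n = Always (Or (Neg (Atom (label_plus_reg k) (of_nat (Suc n)))) (Atom (reg k) (of_nat n)))"

lemma dot_config:
  assumes "0 < k"
  shows "dot (label_plus_reg k) (config k l s) = real l + real (s 0)"
    "dot (reg k) (config k l s) = real (s 0)"
proof -
  obtain j where k: "k = Suc j" using assms gr0_implies_Suc by blast
  have "(\<Sum>i<Suc k. of_rat (of_bool (i \<le> 1)) * config k l s ! i) = real l + real (s 0)"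
    "(\<Sum>i<Suc k. of_rat (of_bool (i = 1)) * config k l s ! i) = real (s 0)"
    unfolding k by (simp_all add: sum.lessThan_Suc_shift del: sum.lessThan_Suc)
  then show "dot (label_plus_reg k) (config k l s) = real l + real (s 0)"
    "dot (reg k) (config k l s) = real (s 0)"
    unfolding label_plus_reg_def reg_def by (simp_all add: dot_map_upt del: upt_Suc)
qed

lemma sat_avoids_iff:
  assumes "0 < k" "\<And>t. x t = config k (l t) (s t)"
  shows "sat_at x 0 (avoids k n) \<longleftrightarrow> \<not> (\<exists>t. l t = 0 \<and> s t 0 = Suc n)"
proof -
  have "sat_at x 0 (avoids k n) \<longleftrightarrow>
      (\<forall>t. real (l t) + real (s t 0) \<le> real (Suc n) \<longrightarrow> real (s t 0) \<le> real n)"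
    by (simp add: avoids_def assms dot_config[OF assms(1)] of_rat_add)
  also have "\<dots> \<longleftrightarrow> (\<forall>t. l t + s t 0 \<le> Suc n \<longrightarrow> s t 0 \<le> n)"
    by (simp only: of_nat_add[symmetric] of_nat_le_iff)
  also have "\<dots> \<longleftrightarrow> (\<forall>t. \<not> (l t = 0 \<and> s t 0 = Suc n))"
    by (intro arg_cong[where f = All] ext) presburger
  finally show ?thesis by blast
qed

text \<open>A terminating run becomes a violating path by stuttering at the exit. Conversely, an
  inductive labelling whose set at the exit consists of the final stores of \<open>P\<close> is
  followed along a violating path.\<close>

lemma prog_mas_satisfies_iff:
  assumes k: "0 < k" and regs: "prog_regs P \<subseteq> {..<k}"
  shows "prog_mas k P \<Turnstile> avoids k n \<longleftrightarrow> \<not> (\<exists>s. ((\<lambda>_. 0), s) \<in> prog_rel P \<and> s 0 = Suc n)"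
proof -
  define E where "E = edges P 1 0 2"
  define s0 :: store where "s0 = (\<lambda>_. 0)"
  have E_regs: "act_regs a \<subseteq> {..<k}" if "(p, a, q) \<in> set E" for p a q
    using edges_regs[of p a q P 1 0 2] that regs k by (auto simp: E_def)
  have step: "holds (trans_constr k E) (config k l s @ x') \<longleftrightarrow>
      x' = config k l s \<or> (\<exists>q s'. ((l, s), (q, s')) \<in> edge_rel E \<and> x' = config k q s')"
    if "length x' = Suc k" for l s x'
    using that E_regs by (rule holds_trans_constr)
  have sat: "prog_mas k P \<Turnstile> avoids k n \<longleftrightarrow>
      (\<forall>x. (\<forall>t. length (x t) = Suc k \<and> holds (trans_constr k E) (x t @ x (Suc t))) \<and>
           holds (init_constr k) (x 0) \<longrightarrow> sat_at x 0 (avoids k n))"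
    unfolding prog_mas_def closed_mas_satisfies_iff E_def ..
  have "\<not> prog_mas k P \<Turnstile> avoids k n" if s: "(s0, s) \<in> prog_rel P" "s 0 = Suc n" for s
  proof -
    have "((1, s0), (0, s)) \<in> (edge_rel E)\<^sup>*"
      using edges_complete[OF s(1), of 1 0 2 E] by (simp add: E_def)
    then obtain m where "((1, s0), (0, s)) \<in> edge_rel E ^^ m" by (auto simp: rtrancl_power)
    then obtain c where c: "c 0 = (1, s0)" "c m = (0, s)"
      "\<And>i. i < m \<Longrightarrow> (c i, c (Suc i)) \<in> edge_rel E"
      by (auto simp: relpow_fun_conv)
    \<comment> \<open>Taking the minimum with \<open>m\<close> freezes the run once the exit is
      reached; from then on the path stutters.\<close>
    define l u where "l = (\<lambda>t. fst (c (min t m)))" and "u = (\<lambda>t. snd (c (min t m)))"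
    define x where "x = (\<lambda>t. config k (l t) (u t))"
    have "holds (trans_constr k E) (x t @ x (Suc t))" for t
    proof (cases "t < m")
      case True
      then have "((l t, u t), (l (Suc t), u (Suc t))) \<in> edge_rel E"
        using c(3)[OF True] by (simp add: l_def u_def min_def)
      then show ?thesis unfolding x_def by (subst step) auto
    next
      case False
      then have "x (Suc t) = config k (l t) (u t)" by (simp add: x_def l_def u_def min_def)
      then show ?thesis unfolding x_def by (subst step) auto
    qed
    moreover have "holds (init_constr k) (x 0)"
      using c(1) by (simp add: holds_init x_def l_def u_def s0_def)
    moreover have "\<not> sat_at x 0 (avoids k n)"
    proof -
      have "l m = 0" "u m 0 = Suc n" using c(2) s(2) by (simp_all add: l_def u_def)
      then show ?thesis using sat_avoids_iff[OF k, of x l u n] unfolding x_def by blast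
    qed
    moreover have "length (x t) = Suc k" for t by (simp add: x_def)
    ultimately show ?thesis unfolding sat by blast
  qed
  moreover have "\<exists>s. (s0, s) \<in> prog_rel P \<and> s 0 = Suc n" if "\<not> prog_mas k P \<Turnstile> avoids k n"
  proof -
    from that obtain x where x: "\<And>t. length (x t) = Suc k"
      "\<And>t. holds (trans_constr k E) (x t @ x (Suc t))" "holds (init_constr k) (x 0)"
      "\<not> sat_at x 0 (avoids k n)"
      unfolding sat by blast
    \<comment> \<open>Only the sets at labels \<open>0\<close> and \<open>1\<close> matter here;
      those at inner labels are chosen by \<open>edges_labelling\<close>.\<close>
    define W where "W = (\<lambda>l::nat. if l = 1 then {s0} else prog_rel P `` {s0})"
    obtain W' where W': "\<forall>l. l < 2 \<or> 2 + prog_size P \<le> l \<longrightarrow> W' l = W l" "inductive_labelling E W'"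
      using edges_labelling[of P W 1 0 2] by (auto simp: W_def E_def)
    have "\<exists>l s. x t = config k l s \<and> s \<in> W' l" for t
    proof (induction t)
      case 0
      have "x 0 = config k 1 s0" using x(1,3) by (simp add: holds_init s0_def)
      moreover have "s0 \<in> W' 1" using W'(1) by (simp add: W_def)
      ultimately show ?case by blast
    next
      case (Suc t)
      then obtain l s where ls: "x t = config k l s" "s \<in> W' l" by blast
      have "holds (trans_constr k E) (config k l s @ x (Suc t))" using x(2)[of t] ls(1) by simp
      then consider "x (Suc t) = config k l s"
        | q s' where "((l, s), (q, s')) \<in> edge_rel E" "x (Suc t) = config k q s'"
        using step[OF x(1)] by blast
      then show ?case
      proof cases
        case 1
        then show ?thesis using ls(2) by blast
      next
        case 2
        then have "s' \<in> W' q"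
          using W'(2) ls(2) by (fastforce simp: edge_rel_def inductive_labelling_def)
        then show ?thesis using 2(2) by blast
      qed
    qed
    then obtain l u where lu: "\<And>t. x t = config k (l t) (u t)" "\<And>t. u t \<in> W' (l t)" by metis
    obtain t where "l t = 0" "u t 0 = Suc n" using x(4) sat_avoids_iff[OF k, of x l u n] lu(1) by blast
    moreover from this have "u t \<in> W 0" using lu(2)[of t] W'(1) by simp
    ultimately show ?thesis by (auto simp: W_def)
  qed
  ultimately show ?thesis unfolding s0_def by blast
qed

section \<open>Computing the encoding of an instance\<close>

definition rec_add :: recf where
  "rec_add = PrimRec (Proj 0) (Comp Succ [Proj 1])"

definition rec_triangle :: recf where
  "rec_triangle = PrimRec Zero (Comp rec_add [Proj 1, Comp Succ [Proj 0]])"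

definition rec_prod_encode :: recf where
  "rec_prod_encode = Comp rec_add [Comp rec_triangle [rec_add], Proj 0]"

definition rec_pair :: "recf \<Rightarrow> recf \<Rightarrow> recf" where
  "rec_pair a b = Comp rec_prod_encode [a, b]"

primrec rec_const :: "nat \<Rightarrow> recf" where
  "rec_const 0 = Zero"
| "rec_const (Suc n) = Comp Succ [rec_const n]"

primrec rec_list :: "recf list \<Rightarrow> recf" where
  "rec_list [] = Zero"
| "rec_list (g # gs) = Comp Succ [rec_pair g (rec_list gs)]"

text \<open>The natural \<open>n\<close> is the fraction with numerator \<open>n\<close> and
  denominator \<open>1\<close>, and \<open>int_encode\<close> doubles nonnegative integers.\<close>

definition rec_rat :: "recf \<Rightarrow> recf" where
  "rec_rat g = rec_pair (Comp rec_add [g, g]) (rec_const 2)"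

lemma rec_eval_Comp1:
  "rec_eval g xs y \<Longrightarrow> rec_eval f [y] z \<Longrightarrow> rec_eval (Comp f [g]) xs z"
  by (rule rec_eval.Comp[where ys = "[y]"]) auto

lemma rec_eval_Comp2:
  "rec_eval g xs y \<Longrightarrow> rec_eval h xs z \<Longrightarrow> rec_eval f [y, z] w \<Longrightarrow> rec_eval (Comp f [g, h]) xs w"
  by (rule rec_eval.Comp[where ys = "[y, z]"]) auto

lemma rec_eval_Proj: "i < length xs \<Longrightarrow> y = xs ! i \<Longrightarrow> rec_eval (Proj i) xs y"
  by (simp add: rec_eval.Proj)

lemma rec_eval_Comp_Succ: "rec_eval g xs y \<Longrightarrow> rec_eval (Comp Succ [g]) xs (Suc y)"
  by (rule rec_eval_Comp1) (auto intro: rec_eval.Succ)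

lemma rec_eval_add: "rec_eval rec_add [x, y] (x + y)"
proof (induction x)
  case 0
  show ?case unfolding rec_add_def by (auto intro!: rec_eval.PrimRec_0 rec_eval_Proj)
next
  case (Suc x)
  then show ?case unfolding rec_add_def
    by (auto intro!: rec_eval.PrimRec_Suc[where y = "x + y"] rec_eval_Comp_Succ rec_eval_Proj)
qed

lemma rec_eval_triangle: "rec_eval rec_triangle [x] (triangle x)"
proof (induction x)
  case 0
  show ?case unfolding rec_triangle_def by (auto intro!: rec_eval.PrimRec_0 rec_eval.Zero)
next
  case (Suc x)
  have "rec_eval (Comp rec_add [Proj 1, Comp Succ [Proj 0]]) [x, triangle x] (triangle (Suc x))"
    unfolding triangle_Suc
    by (rule rec_eval_Comp2[OF _ _ rec_eval_add]) (auto intro!: rec_eval_Comp_Succ rec_eval_Proj)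
  with Suc show ?case unfolding rec_triangle_def by (rule rec_eval.PrimRec_Suc)
qed

lemma rec_eval_prod_encode: "rec_eval rec_prod_encode [x, y] (prod_encode (x, y))"
  unfolding rec_prod_encode_def prod_encode_def prod.case
  by (rule rec_eval_Comp2[OF _ _ rec_eval_add])
    (auto intro!: rec_eval_Proj rec_eval_Comp1[OF rec_eval_add rec_eval_triangle])

lemma rec_eval_pair:
  "rec_eval a xs x \<Longrightarrow> rec_eval b xs y \<Longrightarrow> rec_eval (rec_pair a b) xs (prod_encode (x, y))"
  unfolding rec_pair_def by (erule rec_eval_Comp2) (auto intro: rec_eval_prod_encode)

lemma rec_eval_const: "rec_eval (rec_const n) xs n"
  by (induction n) (auto intro: rec_eval.Zero rec_eval_Comp_Succ)

lemma rec_eval_list: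
  "list_all2 (\<lambda>g y. rec_eval g xs y) gs ys \<Longrightarrow> rec_eval (rec_list gs) xs (list_encode ys)"
  by (induction rule: list_all2_induct) (auto intro: rec_eval.Zero rec_eval_Comp_Succ rec_eval_pair)

lemma encode_rat_of_nat: "encode_rat (of_nat n) = prod_encode (n + n, 2)"
proof -
  have "quotient_of (of_nat n) = (int n, 1)"
    using quotient_of_int[of "int n"] by simp
  then show ?thesis by (simp add: encode_rat_def int_encode_def sum_encode_def)
qed

lemma rec_eval_rat: "rec_eval g xs n \<Longrightarrow> rec_eval (rec_rat g) xs (encode_rat (of_nat n))"
  unfolding rec_rat_def encode_rat_of_nat
  by (intro rec_eval_pair rec_eval_Comp2[OF _ _ rec_eval_add] rec_eval_const)

text \<open>The system enters only through its code \<open>n + 1\<close>, so no description has to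
  be built; just the formula is encoded. The constants 7, 3, 1 and 0 are the tags of
  \<open>Always\<close>, \<open>Or\<close>, \<open>Neg\<close> and \<open>Atom\<close>, and
  arguments 1 and 2 are the codes of the coefficient vectors.\<close>

definition rec_instance :: recf where
  "rec_instance = rec_pair (Comp Succ [Proj 0]) (rec_list [rec_const 7,
     rec_list [rec_const 3,
       rec_list [rec_const 1, rec_list [rec_const 0, Proj 1, rec_rat (Comp Succ [Proj 0])]],
       rec_list [rec_const 0, Proj 2, rec_rat (Proj 0)]]])"

lemma rec_eval_instance:
  assumes "encode_mas D = Suc n"
  shows "rec_eval rec_instance [n, encode_rats (label_plus_reg k), encode_rats (reg k)]
    (encode_instance D (avoids k n))"
proof -
  have Proj: "rec_eval (Proj 0) [a, b, c] a" "rec_eval (Proj 1) [a, b, c] b"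
    "rec_eval (Proj 2) [a, b, c] c" for a b c
    by (simp_all add: rec_eval_Proj)
  show ?thesis
    unfolding rec_instance_def encode_instance_def avoids_def encode_ltl.simps assms
    by (intro rec_eval_pair rec_eval_list rec_eval_rat rec_eval_Comp_Succ rec_eval_const Proj
        list_all2_Cons[THEN iffD2] conjI list.rel_intros(1))
qed

section \<open>Diagonalization\<close>

text \<open>Allows the code to be written as \<open>Suc n\<close>. With this shift the bounds
  \<open>n + 1\<close> and \<open>n\<close> in \<open>avoids\<close> are computed from
  \<open>n\<close> without a predecessor function.\<close>

lemma encode_mas_neq_0: "encode_mas D \<noteq> 0"
  by (simp add: encode_mas_def)

text \<open>
  The codes of the coefficient vectors depend on the number \<open>k\<close> of registers. They are assigned to
  registers as constants instead of being part of \<open>g\<close>, because \<open>k\<close> depends on \<open>g\<close>.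
\<close>

lemma diagonal_prog:
  "\<exists>k P. 0 < k \<and> prog_regs P \<subseteq> {..<k} \<and>
     (\<forall>n. (\<exists>s. ((\<lambda>_. 0), s) \<in> prog_rel P \<and> s 0 = Suc n) \<longleftrightarrow>
        rec_eval g [n, encode_rats (label_plus_reg k), encode_rats (reg k)] 1)"
proof -
  \<comment> \<open>The bound \<open>4\<close> protects register \<open>0\<close>, so the guess
    survives the run of \<open>Q\<close> and can be output afterwards.\<close>
  obtain Q k where Q: "implements Q 4 k [0, 1, 2] 3 g"
    using implementable[of "[0, 1, 2]" 4 3 g] by auto
  \<comment> \<open>Here \<open>k\<close> is already fixed by \<open>Q\<close>, and the surrounding
    code uses only registers below \<open>4\<close>, hence below \<open>k\<close>.\<close>
  define A B where "A = encode_rats (label_plus_reg k)" and "B = encode_rats (reg k)"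
  define P where "P = Seq (Star (Act (Assign 0 [0] 1))) (Seq (Act (Assign 1 [] A))
    (Seq (Act (Assign 2 [] B)) (Seq Q (Seq (Act (Test 3 [] 1)) (Act (Assign 0 [0] 1))))))"
  let ?s = "\<lambda>m. ((\<lambda>_. 0)(0 := m, 1 := A, 2 := B)) :: store"
  have rel: "((\<lambda>_. 0), s) \<in> prog_rel P \<longleftrightarrow>
      (\<exists>m u. (?s m, u) \<in> prog_rel Q \<and> u 3 = 1 \<and> s = u(0 := Suc (u 0)))" for s
    unfolding P_def prog_rel_Seq_iff prog_rel_count_up_iff by auto
  have args: "map (?s m) [0, 1, 2] = [m, A, B]" for m by simp
  have "(\<exists>s. ((\<lambda>_. 0), s) \<in> prog_rel P \<and> s 0 = Suc n) \<longleftrightarrow> rec_eval g [n, A, B] 1" for n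
  proof
    assume "\<exists>s. ((\<lambda>_. 0), s) \<in> prog_rel P \<and> s 0 = Suc n"
    then obtain m u where u: "(?s m, u) \<in> prog_rel Q" "u 3 = 1" "u 0 = n"
      unfolding rel by auto
    have "u 0 = m" using implementsD(4)[OF Q u(1), of 0] by simp
    then show "rec_eval g [n, A, B] 1" using implementsD(3)[OF Q u(1)] u(2,3) args by simp
  next
    assume "rec_eval g [n, A, B] 1"
    then obtain u where u: "(?s n, u) \<in> prog_rel Q" "u 3 = 1"
      using implementsD(5)[OF Q, of "?s n" 1] args by auto
    have "u 0 = n" using implementsD(4)[OF Q u(1), of 0] by simp
    then show "\<exists>s. ((\<lambda>_. 0), s) \<in> prog_rel P \<and> s 0 = Suc n"
      unfolding rel using u by (intro exI[of _ "u(0 := Suc (u 0))"]) auto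
  qed
  moreover have "0 < k" "prog_regs P \<subseteq> {..<k}"
    using implementsD(1,2)[OF Q] by (auto simp: P_def)
  ultimately show ?thesis unfolding A_def B_def by blast
qed

theorem theorem4p1:
  shows "\<not> (\<exists>f. \<forall>S D \<phi>.
           wf_mn_mas S \<and> linearly_defines D S \<and> ltl_over (env_dim S) \<phi> \<longrightarrow>
           rec_eval f [encode_instance D \<phi>] (if S \<Turnstile> \<phi> then 1 else 0))"
proof
  assume "\<exists>f. \<forall>S D \<phi>.
           wf_mn_mas S \<and> linearly_defines D S \<and> ltl_over (env_dim S) \<phi> \<longrightarrow>
           rec_eval f [encode_instance D \<phi>] (if S \<Turnstile> \<phi> then 1 else 0)"
  then obtain f where f: "\<And>S D \<phi>. wf_mn_mas S \<Longrightarrow> linearly_defines D S \<Longrightarrow> ltl_over (env_dim S) \<phi> \<Longrightarrow>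
      rec_eval f [encode_instance D \<phi>] (if S \<Turnstile> \<phi> then 1 else 0)"
    by blast
  \<comment> \<open>On guess \<open>n\<close> the program asks \<open>f\<close> about the system
    with code \<open>n + 1\<close>.\<close>
  obtain k P where k: "0 < k" and P: "prog_regs P \<subseteq> {..<k}"
    and run: "\<And>n. (\<exists>s. ((\<lambda>_. 0), s) \<in> prog_rel P \<and> s 0 = Suc n) \<longleftrightarrow>
      rec_eval (Comp f [rec_instance]) [n, encode_rats (label_plus_reg k), encode_rats (reg k)] 1"
    using diagonal_prog[of "Comp f [rec_instance]"] by blast
  \<comment> \<open>Self-reference needs no recursion theorem: among all guesses is the one that
    denotes the program's own system.\<close>
  obtain n where n: "encode_mas (prog_desc k P) = Suc n"
    using encode_mas_neq_0 not0_implies_Suc by blast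
  let ?c = "encode_instance (prog_desc k P) (avoids k n)"
  let ?args = "[n, encode_rats (label_plus_reg k), encode_rats (reg k)]"
  have "linearly_defines (prog_desc k P) (prog_mas k P)"
    unfolding prog_desc_def prog_mas_def
    by (rule linearly_defines_closed_mas) (rule constr_over_init constr_over_trans)+
  moreover have "wf_mn_mas (prog_mas k P)"
    unfolding prog_mas_def by (rule wf_closed_mas)
  moreover have "ltl_over (env_dim (prog_mas k P)) (avoids k n)"
    by (simp add: prog_mas_def closed_mas_def avoids_def label_plus_reg_def reg_def)
  ultimately have dec: "rec_eval f [?c] (if prog_mas k P \<Turnstile> avoids k n then 1 else 0)"
    using f by blast
  have inst: "rec_eval rec_instance ?args ?c" by (rule rec_eval_instance[OF n])
  have "rec_eval (Comp f [rec_instance]) ?args 1 \<longleftrightarrow> rec_eval f [?c] 1"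
  proof
    assume "rec_eval (Comp f [rec_instance]) ?args 1"
    then obtain ys where "list_all2 (\<lambda>g y. rec_eval g ?args y) [rec_instance] ys" "rec_eval f ys 1"
      by (rule rec_evalE(4))
    then show "rec_eval f [?c] 1"
      using rec_eval_deterministic[OF inst] by (auto simp: list_all2_Cons1)
  qed (rule rec_eval_Comp1[OF inst])
  \<comment> \<open>The exit is reached with value \<open>n + 1\<close> iff \<open>f\<close> answers
    \<open>1\<close>, and this is exactly what violates the specification.\<close>
  then have "prog_mas k P \<Turnstile> avoids k n \<longleftrightarrow> \<not> rec_eval f [?c] 1"
    using prog_mas_satisfies_iff[OF k P, of n] run[of n] by simp
  then show False using dec rec_eval_deterministic[OF dec, of 1] by (auto split: if_splits)
qed

end
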